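(* Let $I=\mathbb{R}$ or $I=[0,\infty)$ and let $X$ be a complex Banach space. Let $ANP_{0}(I:X)$ be the linear span of all almost anti-periodic functions $I\to X$, and let $ANP(I:X)$ be the closure of $ANP_{0}(I:X)$ in $AP(I:X)$ with respect to the sup-norm. Then $$ANP(I:X)=AP_{\mathbb{R}\setminus\{0\}}(I:X).$$
   Context: Let $(X,\|\cdot\|)$ be a complex Banach space and $I=\mathbb{R}$ or $I=[0,\infty)$. A subset $S\subseteq I$ is relatively dense in $I$ if there exists $l>0$ such that every subinterval of $I$ of length $l$ meets $S$. Let $f:I\to X$ be continuous and $\epsilon>0$. A number $\tau\in I\setminus\{0\}$ is an $\epsilon$-period for $f$ if $\|f(t+\tau)-f(t)\|\le\epsilon$ for all $t\in I$, and an $\epsilon$-antiperiod for $f$ if $\|f(t+\tau)+f(t)\|\le\epsilon$ for all $t\in I$. The function $f$ is almost periodic (resp. almost anti-periodic) if for each $\epsilon>0$ the set of all $\epsilon$-periods (resp. $\epsilon$-antiperiods) of $f$ is relatively dense in $I$. $AP(I:X)$ denotes the Banach space of all almost periodic functions $I\to X$ with the sup-norm. Every almost anti-periodic function $I\to X$ is almost periodic, so $ANP_0(I:X)\subseteq AP(I:X)$. For $f\in AP(I:X)$ and $r\in\mathbb{R}$, the Bohr transform $P_r(f):=\lim_{t\to\infty}\frac1t\int_0^t e^{-irs}f(s)\,ds$ exists; put $\sigma(f):=\{r\in\mathbb{R}: P_r(f)\ne 0\}$. For a non-empty $\Lambda\subseteq\mathbb{R}$, $AP_\Lambda(I:X):=\{f\in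 AP(I:X):\sigma(f)\subseteq\Lambda\}$. *)

theory Defs
  imports "HOL-Analysis.Analysis" "HOL-Library.Function_Algebras"
begin

text \<open>The distribution has no type class of complex normed spaces. The real scalar multiplication
  is required to be the restriction of the complex one.\<close>

class complex_vector = real_vector +
  fixes scaleC :: "complex \<Rightarrow> 'a \<Rightarrow> 'a" (infixr "*\<^sub>C" 75)
  assumes scaleC_add_right: "a *\<^sub>C (x + y) = a *\<^sub>C x + a *\<^sub>C y"
    and scaleC_add_left: "(a + b) *\<^sub>C x = a *\<^sub>C x + b *\<^sub>C x"
    and scaleC_scaleC: "a *\<^sub>C (b *\<^sub>C x) = (a * b) *\<^sub>C x"
    and scaleC_one: "1 *\<^sub>C x = x"
    and scaleR_scaleC: "r *\<^sub>R x = complex_of_real r *\<^sub>C x"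

class complex_normed_vector = complex_vector + real_normed_vector +
  assumes norm_scaleC: "norm (a *\<^sub>C x) = cmod a * norm x"

class complex_banach = complex_normed_vector + banach

instantiation complex :: complex_banach
begin

definition scaleC_complex :: "complex \<Rightarrow> complex \<Rightarrow> complex"
  where "scaleC_complex a x = a * x"

instance
  by standard (simp_all add: scaleC_complex_def algebra_simps norm_mult scaleR_conv_of_real)

end

text \<open>A function \<open>I \<rightarrow> X\<close> is represented by the unique function on all of \<^typ>\<open>real\<close> that
  extends it by \<open>0\<close> outside \<open>I\<close>. This makes the representation faithful and compatible with the
  pointwise vector space operations of \<^theory>\<open>HOL-Library.Function_Algebras\<close>.\<close>

definition functions_on :: "real set \<Rightarrow> (real \<Rightarrow> 'a::zero) set"
  where "functions_on I = {f. \<forall>t. t \<notin> I \<longrightarrow> f t = 0}"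

definition relatively_dense :: "real set \<Rightarrow> real set \<Rightarrow> bool"
  where "relatively_dense I S \<longleftrightarrow>
    S \<subseteq> I \<and> (\<exists>l>0. \<forall>a. {a..a + l} \<subseteq> I \<longrightarrow> {a..a + l} \<inter> S \<noteq> {})"

definition periods :: "real set \<Rightarrow> (real \<Rightarrow> 'a::real_normed_vector) \<Rightarrow> real \<Rightarrow> real set"
  where "periods I f \<epsilon> = {\<tau> \<in> I - {0}. \<forall>t\<in>I. norm (f (t + \<tau>) - f t) \<le> \<epsilon>}"

definition antiperiods :: "real set \<Rightarrow> (real \<Rightarrow> 'a::real_normed_vector) \<Rightarrow> real \<Rightarrow> real set"
  where "antiperiods I f \<epsilon> = {\<tau> \<in> I - {0}. \<forall>t\<in>I. norm (f (t + \<tau>) + f t) \<le> \<epsilon>}"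

definition almost_periodic :: "real set \<Rightarrow> (real \<Rightarrow> 'a::real_normed_vector) \<Rightarrow> bool"
  where "almost_periodic I f \<longleftrightarrow>
    continuous_on I f \<and> (\<forall>\<epsilon>>0. relatively_dense I (periods I f \<epsilon>))"

definition almost_anti_periodic :: "real set \<Rightarrow> (real \<Rightarrow> 'a::real_normed_vector) \<Rightarrow> bool"
  where "almost_anti_periodic I f \<longleftrightarrow>
    continuous_on I f \<and> (\<forall>\<epsilon>>0. relatively_dense I (antiperiods I f \<epsilon>))"

definition AP :: "real set \<Rightarrow> (real \<Rightarrow> 'a::complex_banach) set"
  where "AP I = {f \<in> functions_on I. almost_periodic I f}"

text \<open>The sup-norm is only meaningful for bounded functions, such as the elements of \<^term>\<open>AP I\<close>
  (see \<open>AP_bounded\<close> below). The value \<open>0\<close> elsewhere is a totalization, because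
  \<^locale>\<open>Metric_space\<close> constrains the distance also outside its carrier.\<close>

definition sup_norm :: "real set \<Rightarrow> (real \<Rightarrow> 'a::real_normed_vector) \<Rightarrow> real"
  where "sup_norm I f = (if bounded (f ` I) then SUP t\<in>I. norm (f t) else 0)"

definition sup_dist :: "real set \<Rightarrow> (real \<Rightarrow> 'a::real_normed_vector) \<Rightarrow> (real \<Rightarrow> 'a) \<Rightarrow> real"
  where "sup_dist I f g = sup_norm I (\<lambda>t. f t - g t)"

abbreviation AP_topology :: "real set \<Rightarrow> (real \<Rightarrow> 'a::complex_banach) topology"
  where "AP_topology I \<equiv> Metric_space.mtopology (AP I) (sup_dist I)"

definition fun_scaleC :: "complex \<Rightarrow> (real \<Rightarrow> 'a::complex_vector) \<Rightarrow> real \<Rightarrow> 'a"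
  where "fun_scaleC c f = (\<lambda>t. c *\<^sub>C f t)"

definition ANP0 :: "real set \<Rightarrow> (real \<Rightarrow> 'a::complex_banach) set"
  where "ANP0 I = module.span fun_scaleC {f \<in> functions_on I. almost_anti_periodic I f}"

definition ANP :: "real set \<Rightarrow> (real \<Rightarrow> 'a::complex_banach) set"
  where "ANP I = AP_topology I closure_of ANP0 I"

definition bohr_transform :: "real \<Rightarrow> (real \<Rightarrow> 'a::complex_banach) \<Rightarrow> 'a"
  where "bohr_transform r f =
    Lim at_top (\<lambda>t. (1 / t) *\<^sub>R integral {0..t} (\<lambda>s. exp (- (\<i> * of_real r * of_real s)) *\<^sub>C f s))"

definition bohr_spectrum :: "(real \<Rightarrow> 'a::complex_banach) \<Rightarrow> real set"
  where "bohr_spectrum f = {r. bohr_transform r f \<noteq> 0}"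

definition AP_spec :: "real set \<Rightarrow> real set \<Rightarrow> (real \<Rightarrow> 'a::complex_banach) set"
  where "AP_spec \<Lambda> I = {f \<in> AP I. bohr_spectrum f \<subseteq> \<Lambda>}"

text \<open>The locales whose constants are used above do apply to these arguments.\<close>

lemma vector_space_fun_scaleC:
  "vector_space (fun_scaleC :: complex \<Rightarrow> (real \<Rightarrow> 'a::complex_vector) \<Rightarrow> real \<Rightarrow> 'a)"
  by unfold_locales
    (simp_all add: fun_scaleC_def plus_fun_def scaleC_add_right scaleC_add_left scaleC_scaleC scaleC_one)

lemma module_fun_scaleC:
  "module (fun_scaleC :: complex \<Rightarrow> (real \<Rightarrow> 'a::complex_vector) \<Rightarrow> real \<Rightarrow> 'a)"
  by (simp add: module_iff_vector_space vector_space_fun_scaleC)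

lemma AP_bounded:
  assumes I: "I = UNIV \<or> I = {0..}" and f: "f \<in> AP I"
  shows "bounded (f ` I)"
proof -
  have c: "continuous_on I f" and "relatively_dense I (periods I f 1)"
    using f by (auto simp: AP_def almost_periodic_def)
  then obtain l where l: "l > 0"
    and meets: "\<And>a. {a..a + l} \<subseteq> I \<Longrightarrow> {a..a + l} \<inter> periods I f 1 \<noteq> {}"
    unfolding relatively_dense_def by blast
  have "{0..l} \<subseteq> I" using I by auto
  then have "bounded (f ` {0..l})"
    by (meson c compact_Icc compact_continuous_image compact_imp_bounded continuous_on_subset)
  then obtain B where B: "\<And>t. t \<in> {0..l} \<Longrightarrow> norm (f t) \<le> B"
    unfolding bounded_iff by blast
  have "norm (f t) \<le> B + 1" if t: "t \<in> I" for t
  proof (cases "t \<in> {0..l}")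
    case True
    then show ?thesis using B[of t] by simp
  next
    case False
    then have "{t - l..t - l + l} \<subseteq> I" using I t by auto
    from meets[OF this] obtain \<tau> where \<tau>: "\<tau> \<in> periods I f 1" "t - l \<le> \<tau>" "\<tau> \<le> t"
      by auto
    then have s: "t - \<tau> \<in> {0..l}" by auto
    then have "norm (f (t - \<tau> + \<tau>) - f (t - \<tau>)) \<le> 1"
      using \<tau>(1) \<open>{0..l} \<subseteq> I\<close> unfolding periods_def by blast
    moreover have "norm (f t) \<le> norm (f t - f (t - \<tau>)) + norm (f (t - \<tau>))"
      by (metis diff_add_cancel norm_triangle_ineq)
    ultimately show ?thesis using B[OF s] by simp
  qed
  then show ?thesis by (auto simp: bounded_iff)
qed

lemma AP_Metric_space:
  assumes I: "I = UNIV \<or> I = {0..}"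
  shows "Metric_space (AP I :: (real \<Rightarrow> 'a::complex_banach) set) (sup_dist I)"
proof -
  have ne: "I \<noteq> {}" using I by auto
  have upper: "norm (h t) \<le> (SUP t\<in>I. norm (h t))"
    if "bounded (h ` I)" "t \<in> I" for h :: "real \<Rightarrow> 'a" and t
    using that by (intro cSUP_upper) (auto simp: bounded_iff bdd_above_def)
  have bdd: "bounded ((\<lambda>t. f t - g t) ` I)" if "f \<in> AP I" "g \<in> AP I" for f g :: "real \<Rightarrow> 'a"
    using AP_bounded[OF I that(1)] AP_bounded[OF I that(2)] by (rule bounded_minus_comp)
  show ?thesis
  proof
    fix f g :: "real \<Rightarrow> 'a"
    show "0 \<le> sup_dist I f g"
    proof (cases "bounded ((\<lambda>t. f t - g t) ` I)")
      case True
      obtain t where "t \<in> I" using ne by blast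
      from order_trans[OF norm_ge_zero upper[OF True this]] True show ?thesis
        by (simp add: sup_dist_def sup_norm_def)
    qed (simp add: sup_dist_def sup_norm_def)
    show "sup_dist I f g = sup_dist I g f"
      unfolding sup_dist_def sup_norm_def bounded_iff
      by (simp only: ball_simps norm_minus_commute[of "g _" "f _"])
  next
    fix f g :: "real \<Rightarrow> 'a" assume fg: "f \<in> AP I" "g \<in> AP I"
    show "sup_dist I f g = 0 \<longleftrightarrow> f = g"
    proof
      assume "sup_dist I f g = 0"
      then have "norm (f t - g t) \<le> 0" if "t \<in> I" for t
        using upper[OF bdd[OF fg] that] bdd[OF fg] by (simp add: sup_dist_def sup_norm_def)
      moreover have "f t = g t" if "t \<notin> I" for t
        using that fg by (auto simp: AP_def functions_on_def)
      ultimately show "f = g" by (metis eq_iff_diff_eq_0 norm_le_zero_iff ext)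
    next
      assume "f = g"
      then show "sup_dist I f g = 0" using ne by (simp add: sup_dist_def sup_norm_def)
    qed
  next
    fix f g h :: "real \<Rightarrow> 'a" assume fgh: "f \<in> AP I" "g \<in> AP I" "h \<in> AP I"
    have "norm (f t - h t) \<le> (SUP t\<in>I. norm (f t - g t)) + (SUP t\<in>I. norm (g t - h t))"
      if "t \<in> I" for t
      using upper[OF bdd[OF fgh(1,2)] that] upper[OF bdd[OF fgh(2,3)] that]
        norm_triangle_ineq[of "f t - g t" "g t - h t"] by simp
    then show "sup_dist I f h \<le> sup_dist I f g + sup_dist I g h"
      using bdd fgh ne by (auto simp: sup_dist_def sup_norm_def intro!: cSUP_least)
  qed
qed

end

theory Submission
  imports Defs
begin

text \<open>The mean of an almost anti-periodic function vanishes, because the mean of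
  \<open>f(t + \<tau>) + f(t)\<close> is twice the mean of \<open>f\<close>; this passes to spans and uniform limits. Conversely
  every \<open>e\<^sup>i\<^sup>\<omega>\<^sup>t x\<close> with \<open>\<omega> \<noteq> 0\<close> is almost anti-periodic, so everything rests on the approximation
  of almost periodic functions by trigonometric polynomials: the constant term of an approximant is
  close to the mean, and may be dropped if the mean is 0.

  The approximation theorem is proved by Bogolyubov's method, which needs no uniqueness theorem for
  Fourier series. Let \<open>E\<close> be the set of natural numbers \<open>l\<close> for which \<open>l h\<close> is an \<open>\<epsilon>\<close>-period of \<open>f\<close>; it
  has positive lower density. The number of representations \<open>l = b + d - a - c\<close> with entries from
  \<open>E \<inter> {..<m}\<close>, divided by \<open>m\<^sup>3\<close>, is by discrete Fourier analysis within \<open>\<delta>\<^sup>2\<close> of an exponential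
  polynomial in \<open>l\<close> with at most \<open>3/\<delta>\<^sup>2\<close> terms. By compactness, letting \<open>m\<close> tend to infinity gives
  weights \<open>W(l) \<ge> 0\<close> carried by \<open>4\<epsilon>\<close>-periods and close to \<open>P(l) = \<Sum>\<^sub>j b\<^sub>j z\<^sub>j\<^sup>l\<close>. The weighted averages of
  \<open>f(t + l h)\<close> are then close to \<open>f(t)\<close>, and also to a combination of the twisted averages of
  \<open>z\<^sub>j\<^sup>l f(t + l h)\<close>, which over a long window are almost equal to characters.\<close>

section \<open>A limit form of Bogolyubov's lemma\<close>

text \<open>Orthogonality of the characters of the cyclic group of order \<open>M\<close>: for
  \<open>n \<noteq> 0\<close> this is a geometric sum over a nontrivial \<open>M\<close>-th root of
  unity. The bound on \<open>n\<close> rules out nonzero multiples of \<open>M\<close>.\<close>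

lemma sum_cis_roots:
  fixes n :: int
  assumes "\<bar>n\<bar> < int M"
  shows "(\<Sum>k<M. cis (2 * pi * real k * of_int n / real M)) = (if n = 0 then of_nat M else 0)"
proof (cases "n = 0")
  case False
  define w where "w = cis (2 * pi * of_int n / real M)"
  have M: "real M > 0" using assms by linarith
  have "w \<noteq> 1"
  proof
    assume "w = 1"
    then have "cos (2 * pi * of_int n / real M) = 1" by (simp add: w_def complex_eq_iff)
    then obtain k :: int where "2 * pi * of_int n / real M = of_int k * 2 * pi"
      by (auto simp: cos_one_2pi_int)
    then have "real_of_int n = of_int (k * int M)" using M by (simp add: field_simps)
    then have "n = k * int M" by linarith
    then have "int M dvd n" by simp
    with assms False show False using zdvd_imp_le[of "int M" "\<bar>n\<bar>"] by simp
  qed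
  moreover have "w ^ M = 1"
  proof -
    have "w ^ M = cis (2 * pi * of_int n)"
      using M unfolding w_def Complex.DeMoivre by (intro arg_cong[of _ _ cis]) (simp add: field_simps)
    then show ?thesis by (simp add: cis_multiple_2pi)
  qed
  ultimately have "(\<Sum>k<M. w ^ k) = 0" by (simp add: geometric_sum)
  then show ?thesis using False by (simp add: w_def Complex.DeMoivre mult_ac)
qed simp

text \<open>Expanding the fourth power gives one character per quadruple, and summing over
  \<open>k\<close> keeps the quadruples with \<open>l + a + c = b + d\<close>. The modulus
  \<open>3 * m\<close> exceeds every value of \<open>\<bar>l + a + c - b - d\<bar>\<close>, so no
  solution arises by wrap-around modulo \<open>M\<close>.\<close>

lemma fourth_moment_count:
  fixes A :: "nat set"
  assumes A: "A \<subseteq> {..<m}" and l: "l < m"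
  defines "M \<equiv> 3 * m"
  shows "(\<Sum>k<M. of_real (cmod (\<Sum>a\<in>A. cis (2 * pi * real k * real a / real M)) ^ 4)
            * cis (2 * pi * real k * real l / real M))
    = of_nat (M * card {(a, b, c, d). a \<in> A \<and> b \<in> A \<and> c \<in> A \<and> d \<in> A \<and> l + a + c = b + d})"
proof -
  have finA: "finite A" using A finite_subset by blast
  define Q where "Q = A \<times> A \<times> A \<times> A"
  have finQ: "finite Q" using finA by (simp add: Q_def)
  define N :: "nat \<times> nat \<times> nat \<times> nat \<Rightarrow> int"
    where "N = (\<lambda>(a, b, c, d). int l + int a + int c - int b - int d)"
  have "of_real (cmod (\<Sum>a\<in>A. cis (2 * pi * real k * real a / real M)) ^ 4)
          * cis (2 * pi * real k * real l / real M)
        = (\<Sum>q\<in>Q. cis (2 * pi * real k * of_int (N q) / real M))" for k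
  proof -
    define t where "t = 2 * pi * real k / real M"
    define F where "F = (\<Sum>a\<in>A. cis (t * real a))"
    have cF: "cnj F = (\<Sum>a\<in>A. cis (- (t * real a)))" by (simp add: F_def cis_cnj)
    have FF: "F * cnj F = (\<Sum>a\<in>A. \<Sum>b\<in>A. cis (t * real a - t * real b))"
      unfolding cF by (simp add: F_def sum_product cis_mult)
    have "complex_of_real (cmod F ^ 4) = (complex_of_real ((cmod F)\<^sup>2)) ^ 2"
      by (simp flip: power_mult)
    also have "\<dots> = (F * cnj F) * (F * cnj F)"
      unfolding complex_norm_square by (rule power2_eq_square)
    also have "\<dots> = (\<Sum>a\<in>A. \<Sum>b\<in>A. cis (t * real a - t * real b) * (\<Sum>c\<in>A. \<Sum>d\<in>A. cis (t * real c - t * real d)))"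
      unfolding FF by (simp only: sum_distrib_right)
    also have "\<dots> = (\<Sum>a\<in>A. \<Sum>b\<in>A. \<Sum>c\<in>A. \<Sum>d\<in>A. cis (t * real a - t * real b) * cis (t * real c - t * real d))"
      by (simp only: sum_distrib_left)
    finally have "of_real (cmod F ^ 4) * cis (t * real l) = (\<Sum>a\<in>A. \<Sum>b\<in>A. \<Sum>c\<in>A. \<Sum>d\<in>A.
        cis (t * real a - t * real b) * cis (t * real c - t * real d) * cis (t * real l))"
      by (simp only: sum_distrib_right)
    also have "\<dots> = (\<Sum>a\<in>A. \<Sum>b\<in>A. \<Sum>c\<in>A. \<Sum>d\<in>A. cis (t * of_int (N (a, b, c, d))))"
      by (intro sum.cong refl) (simp add: N_def cis_mult algebra_simps)
    also have "\<dots> = (\<Sum>q\<in>Q. cis (t * of_int (N q)))"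
      unfolding Q_def by (simp add: sum.cartesian_product)
    finally show ?thesis by (simp add: F_def t_def mult_ac)
  qed
  then have "(\<Sum>k<M. of_real (cmod (\<Sum>a\<in>A. cis (2 * pi * real k * real a / real M)) ^ 4)
            * cis (2 * pi * real k * real l / real M))
      = (\<Sum>k<M. \<Sum>q\<in>Q. cis (2 * pi * real k * of_int (N q) / real M))" by simp
  also have "\<dots> = (\<Sum>q\<in>Q. \<Sum>k<M. cis (2 * pi * real k * of_int (N q) / real M))"
    by (rule sum.swap)
  also have "\<dots> = (\<Sum>q\<in>Q. if N q = 0 then of_nat M else 0)"
  proof (rule sum.cong)
    fix q assume "q \<in> Q"
    then obtain a b c d where q: "q = (a, b, c, d)" "a \<in> A" "b \<in> A" "c \<in> A" "d \<in> A"
      by (auto simp: Q_def)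
    then have "a < m" "b < m" "c < m" "d < m" using A by auto
    then have "\<bar>N q\<bar> < int M" using l by (simp add: q N_def M_def)
    then show "(\<Sum>k<M. cis (2 * pi * real k * of_int (N q) / real M)) = (if N q = 0 then of_nat M else 0)"
      by (rule sum_cis_roots)
  qed simp
  also have "\<dots> = of_nat (M * card {q \<in> Q. N q = 0})"
    using finQ by (simp add: sum.If_cases Int_def)
  also have "{q \<in> Q. N q = 0} = {(a, b, c, d). a \<in> A \<and> b \<in> A \<and> c \<in> A \<and> d \<in> A \<and> l + a + c = b + d}"
    by (auto simp: Q_def N_def)
  finally show ?thesis .
qed

text \<open>Parseval's identity. It limits both the number of large Fourier coefficients of
  \<open>A\<close> and the total contribution of the small ones.\<close>

lemma second_moment:
  fixes A :: "nat set"
  assumes A: "A \<subseteq> {..<M}"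
  shows "(\<Sum>k<M. cmod (\<Sum>a\<in>A. cis (2 * pi * real k * real a / real M)) ^ 2) = real (M * card A)"
proof -
  have finA: "finite A" using A finite_subset by blast
  have "of_real (cmod (\<Sum>a\<in>A. cis (2 * pi * real k * real a / real M)) ^ 2)
        = (\<Sum>a\<in>A. \<Sum>b\<in>A. cis (2 * pi * real k * of_int (int a - int b) / real M))" for k
  proof -
    define t where "t = 2 * pi * real k / real M"
    define F where "F = (\<Sum>a\<in>A. cis (t * real a))"
    have cF: "cnj F = (\<Sum>a\<in>A. cis (- (t * real a)))" by (simp add: F_def cis_cnj)
    have "of_real (cmod F ^ 2) = F * cnj F" by (simp add: complex_norm_square[symmetric])
    also have "\<dots> = (\<Sum>a\<in>A. \<Sum>b\<in>A. cis (t * of_int (int a - int b)))"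
      unfolding cF by (simp add: F_def sum_product cis_mult algebra_simps)
    finally show ?thesis by (simp add: F_def t_def mult_ac)
  qed
  then have "complex_of_real (\<Sum>k<M. cmod (\<Sum>a\<in>A. cis (2 * pi * real k * real a / real M)) ^ 2)
      = (\<Sum>k<M. \<Sum>a\<in>A. \<Sum>b\<in>A. cis (2 * pi * real k * of_int (int a - int b) / real M))" by simp
  also have "\<dots> = (\<Sum>a\<in>A. \<Sum>b\<in>A. \<Sum>k<M. cis (2 * pi * real k * of_int (int a - int b) / real M))"
    by (subst sum.swap) (rule sum.cong, simp, subst sum.swap, simp)
  also have "\<dots> = (\<Sum>a\<in>A. \<Sum>b\<in>A. if b = a then of_nat M else 0)"
  proof (intro sum.cong refl)
    fix a b assume "a \<in> A" "b \<in> A"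
    then have "\<bar>int a - int b\<bar> < int M" using A by (auto simp: subset_iff abs_less_iff)
    from sum_cis_roots[OF this]
    show "(\<Sum>k<M. cis (2 * pi * real k * of_int (int a - int b) / real M)) = (if b = a then of_nat M else 0)"
      by auto
  qed
  also have "\<dots> = complex_of_real (real (M * card A))"
    using finA by simp
  finally show ?thesis using of_real_eq_iff by blast
qed

text \<open>\<open>W l\<close> is the number of quadruples for \<open>l\<close> divided by
  \<open>m ^ 3\<close>; its Fourier coefficients \<open>F k ^ 4 / D\<close> are nonnegative.
  Parseval leaves at most \<open>3 / \<delta>\<^sup>2\<close> frequencies with
  \<open>F k \<ge> \<delta> * m\<close>, and all others together carry weight at most
  \<open>\<delta>\<^sup>2\<close>. The condition on \<open>J\<close> does not involve
  \<open>m\<close>, which allows \<open>m\<close> to tend to infinity later.\<close>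

lemma bogolyubov_finite:
  fixes A :: "nat set" and c \<delta> :: real
  assumes m: "m > 0" and A: "A \<subseteq> {..<m}" and \<delta>: "\<delta> > 0" and c: "c \<ge> 0" "c * real m \<le> real (card A)"
    and J: "3 / \<delta>\<^sup>2 \<le> real J"
  obtains W :: "nat \<Rightarrow> real" and b :: "nat \<Rightarrow> real" and z :: "nat \<Rightarrow> complex"
  where "\<And>l. 0 \<le> W l"
    and "\<And>l. W l \<noteq> 0 \<Longrightarrow> \<exists>p\<in>A. \<exists>q\<in>A. \<exists>r\<in>A. \<exists>s\<in>A. l + p + q = r + s"
    and "\<And>l. l < m \<Longrightarrow> cmod (of_real (W l) - (\<Sum>j<J. of_real (b j) * z j ^ l)) \<le> \<delta>\<^sup>2"
    and "\<And>j. 0 \<le> b j" and "(\<Sum>j<J. b j) \<le> 1" and "\<And>j. cmod (z j) = 1"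
    and "\<And>L. L \<le> m \<Longrightarrow> real L * (c ^ 4 / 6) \<le> (\<Sum>l<L. W l)"
proof -
  define M where "M = 3 * m"
  have M: "M > 0" using m by (simp add: M_def)
  have finA: "finite A" using A finite_subset by blast
  have cardA: "card A \<le> m" using card_mono[OF _ A] by simp
  define \<theta> where "\<theta> k = 2 * pi * real k / real M" for k
  define F where "F k = cmod (\<Sum>a\<in>A. cis (2 * pi * real k * real a / real M))" for k
  define D :: real where "D = real m ^ 3 * real M"
  have D: "D > 0" using m M by (simp add: D_def)
  define \<beta> where "\<beta> k = F k ^ 4 / D" for k
  define T where "T l = {(a, b, c, d). a \<in> A \<and> b \<in> A \<and> c \<in> A \<and> d \<in> A \<and> l + a + c = b + d}" for l
  define W where "W l = real (card (T l)) / real m ^ 3" for l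
  have F0: "0 \<le> F k" for k by (simp add: F_def)
  have Fm: "F k \<le> real m" for k
  proof -
    have "F k \<le> (\<Sum>a\<in>A. 1)" unfolding F_def by (rule order_trans[OF norm_sum]) simp
    then show ?thesis using cardA by simp
  qed
  have F2: "(\<Sum>k<M. F k ^ 2) \<le> real M * real m"
  proof -
    have "A \<subseteq> {..<M}" using A by (auto simp: M_def)
    then have "(\<Sum>k<M. F k ^ 2) = real M * real (card A)"
      unfolding F_def by (simp add: second_moment)
    also have "\<dots> \<le> real M * real m" using cardA by (intro mult_left_mono) auto
    finally show ?thesis .
  qed
  have \<beta>0: "0 \<le> \<beta> k" for k using D by (simp add: \<beta>_def)
  \<comment> \<open>Of the four factors \<open>F k\<close>, two are estimated by
    \<open>e * m\<close> and two are kept for Parseval's identity.\<close>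
  have \<beta>_le: "\<beta> k \<le> e\<^sup>2 * F k ^ 2 / (real m * real M)" if "F k \<le> e * real m" for k e
  proof -
    have "F k ^ 4 = F k ^ 2 * F k ^ 2" by (simp flip: power_add)
    also have "\<dots> \<le> (e * real m) ^ 2 * F k ^ 2"
      using that F0[of k] by (intro mult_right_mono power_mono) auto
    finally have "\<beta> k \<le> (e * real m) ^ 2 * F k ^ 2 / D"
      unfolding \<beta>_def using D by (simp add: divide_right_mono)
    also have "\<dots> = e\<^sup>2 * F k ^ 2 / (real m * real M)"
      using m M by (simp add: D_def field_simps power2_eq_square power3_eq_cube)
    finally show ?thesis .
  qed
  have \<beta>_sum: "sum \<beta> S \<le> e\<^sup>2" if S: "S \<subseteq> {..<M}" and le: "\<And>k. k \<in> S \<Longrightarrow> F k \<le> e * real m" for S e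
  proof -
    have "sum \<beta> S \<le> (\<Sum>k\<in>S. e\<^sup>2 * F k ^ 2 / (real m * real M))"
      by (intro sum_mono \<beta>_le le)
    also have "\<dots> \<le> (\<Sum>k<M. e\<^sup>2 * F k ^ 2 / (real m * real M))"
      using S by (intro sum_mono2) auto
    also have "\<dots> = e\<^sup>2 * (\<Sum>k<M. F k ^ 2) / (real m * real M)"
      by (simp add: sum_distrib_left sum_divide_distrib)
    also have "\<dots> \<le> e\<^sup>2 * (real M * real m) / (real m * real M)"
      by (intro divide_right_mono mult_left_mono F2) auto
    also have "\<dots> = e\<^sup>2" using m M by simp
    finally show ?thesis .
  qed
  have cis_pow: "cis (2 * pi * real k * real l / real M) = cis (\<theta> k) ^ l" for k l
    by (simp add: Complex.DeMoivre \<theta>_def mult_ac)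
  have W_eq: "of_real (W l) = (\<Sum>k<M. of_real (\<beta> k) * cis (\<theta> k) ^ l)" if "l < m" for l
  proof -
    have "(\<Sum>k<M. of_real (F k ^ 4) * cis (\<theta> k) ^ l) = of_nat (M * card (T l))"
      using fourth_moment_count[OF A that] unfolding F_def M_def[symmetric] T_def cis_pow by simp
    then have "(\<Sum>k<M. of_real (F k ^ 4) * cis (\<theta> k) ^ l) / of_real D = of_nat (M * card (T l)) / of_real D"
      by simp
    moreover have "of_nat (M * card (T l)) / complex_of_real D = of_real (W l)"
      using M by (simp add: D_def W_def)
    ultimately show ?thesis by (simp add: \<beta>_def sum_divide_distrib)
  qed
  define S where "S = {k. k < M \<and> \<delta> * real m \<le> F k}"
  have finS: "finite S" and SM: "S \<subseteq> {..<M}" by (auto simp: S_def)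
  have "real (card S) * (\<delta> * real m)\<^sup>2 = (\<Sum>k\<in>S. (\<delta> * real m)\<^sup>2)" by simp
  also have "\<dots> \<le> (\<Sum>k\<in>S. F k ^ 2)"
    using \<delta> by (intro sum_mono power_mono) (auto simp: S_def)
  also have "\<dots> \<le> (\<Sum>k<M. F k ^ 2)" using SM by (intro sum_mono2) auto
  also have "\<dots> \<le> 3 * (real m)\<^sup>2" using F2 by (simp add: M_def power2_eq_square)
  finally have "real (card S) \<le> 3 / \<delta>\<^sup>2"
    using m \<delta> by (simp add: field_simps power_mult_distrib)
  with J have cardS: "card S \<le> J" by linarith
  obtain e where e: "bij_betw e {..<card S} S"
    using ex_bij_betw_nat_finite[OF finS] by (auto simp: atLeast0LessThan)
  \<comment> \<open>The list is padded to length \<open>J\<close> by zero weights with base 1, so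
    that \<open>cmod (z j) = 1\<close> holds for every \<open>j\<close>.\<close>
  define b where "b j = (if j < card S then \<beta> (e j) else 0)" for j
  define z where "z j = (if j < card S then cis (\<theta> (e j)) else 1)" for j
  have sub: "{..<card S} \<subseteq> {..<J}" using cardS by auto
  have bz: "(\<Sum>j<J. of_real (b j) * z j ^ l) = (\<Sum>k\<in>S. of_real (\<beta> k) * cis (\<theta> k) ^ l)" for l
  proof -
    have "(\<Sum>j<J. of_real (b j) * z j ^ l) = (\<Sum>j<card S. of_real (b j) * z j ^ l)"
      using sub by (intro sum.mono_neutral_right) (auto simp: b_def)
    also have "\<dots> = (\<Sum>j<card S. of_real (\<beta> (e j)) * cis (\<theta> (e j)) ^ l)"
      by (intro sum.cong) (auto simp: b_def z_def)
    also have "\<dots> = (\<Sum>k\<in>S. of_real (\<beta> k) * cis (\<theta> k) ^ l)"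
      by (rule sum.reindex_bij_betw[OF e])
    finally show ?thesis .
  qed
  show ?thesis
  proof
    show "0 \<le> W l" for l by (simp add: W_def)
    show "\<exists>p\<in>A. \<exists>q\<in>A. \<exists>r\<in>A. \<exists>s\<in>A. l + p + q = r + s" if "W l \<noteq> 0" for l
    proof -
      have "T l \<noteq> {}" using that by (auto simp: W_def)
      then show ?thesis by (fastforce simp: T_def)
    qed
    show "cmod (of_real (W l) - (\<Sum>j<J. of_real (b j) * z j ^ l)) \<le> \<delta>\<^sup>2" if l: "l < m" for l
    proof -
      have "of_real (W l) - (\<Sum>j<J. of_real (b j) * z j ^ l) = (\<Sum>k\<in>{..<M} - S. of_real (\<beta> k) * cis (\<theta> k) ^ l)"
        unfolding bz W_eq[OF l] using SM by (simp add: sum_diff)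
      also have "cmod \<dots> \<le> sum \<beta> ({..<M} - S)"
        using \<beta>0 by (intro order_trans[OF norm_sum]) (simp add: norm_mult norm_power)
      also have "\<dots> \<le> \<delta>\<^sup>2" by (rule \<beta>_sum) (auto simp: S_def)
      finally show ?thesis .
    qed
    show "0 \<le> b j" for j using \<beta>0 by (simp add: b_def)
    show "cmod (z j) = 1" for j by (simp add: z_def)
    have "(\<Sum>j<J. b j) = sum \<beta> S"
      using arg_cong[OF bz[of 0], of Re] by simp
    also have "\<dots> \<le> 1\<^sup>2" using Fm by (intro \<beta>_sum SM) simp
    finally show "(\<Sum>j<J. b j) \<le> 1" by simp
    show "real L * (c ^ 4 / 6) \<le> (\<Sum>l<L. W l)" if L: "L \<le> m" for L
    proof (cases "L = 0")
      case False
      \<comment> \<open>The cosine expansion extends \<open>W\<close> from natural arguments to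
        differences of either sign, where it is even; its double sum over a square is a weighted sum
        of squared moduli.\<close>
      define w where "w x y = (\<Sum>k<M. \<beta> k * cos (\<theta> k * (real x - real y)))" for x y
      have w_sym: "w x y = w y x" for x y
      proof -
        have "cos (\<theta> k * (real x - real y)) = cos (\<theta> k * (real y - real x))" for k
          by (subst cos_minus[symmetric]) (simp add: algebra_simps)
        then show ?thesis by (simp add: w_def)
      qed
      have w: "w x y = W (x - y)" if "y \<le> x" "x < L" for x y
      proof -
        have "x - y < m" using that L by simp
        from arg_cong[OF W_eq[OF this], of Re]
        show ?thesis using that by (simp add: w_def Complex.DeMoivre of_nat_diff mult.commute)
      qed
      \<comment> \<open>Fejer's kernel has nonnegative Fourier coefficients, so only the term for frequency 0 is kept.\<close>
      have "\<beta> 0 * (real L)\<^sup>2 \<le> (\<Sum>k<M. \<beta> k * (cmod (\<Sum>x<L. cis (\<theta> k * real x)))\<^sup>2)"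
      proof -
        have "\<beta> 0 * (real L)\<^sup>2 = (\<Sum>k\<in>{0}. \<beta> k * (cmod (\<Sum>x<L. cis (\<theta> k * real x)))\<^sup>2)"
          by (simp add: \<theta>_def)
        also have "\<dots> \<le> (\<Sum>k<M. \<beta> k * (cmod (\<Sum>x<L. cis (\<theta> k * real x)))\<^sup>2)"
          using M \<beta>0 by (intro sum_mono2) auto
        finally show ?thesis .
      qed
      also have "\<dots> = (\<Sum>x<L. \<Sum>y<L. w x y)"
      proof -
        have "(cmod (\<Sum>x<L. cis (\<theta> k * real x)))\<^sup>2 = (\<Sum>x<L. \<Sum>y<L. cos (\<theta> k * (real x - real y)))" for k
        proof -
          have "complex_of_real ((cmod (\<Sum>x<L. cis (\<theta> k * real x)))\<^sup>2)
            = (\<Sum>x<L. \<Sum>y<L. cis (\<theta> k * (real x - real y)))"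
            unfolding complex_norm_square by (simp add: cis_cnj sum_product cis_mult algebra_simps)
          from arg_cong[OF this, of Re] show ?thesis by simp
        qed
        then have "(\<Sum>k<M. \<beta> k * (cmod (\<Sum>x<L. cis (\<theta> k * real x)))\<^sup>2)
          = (\<Sum>k<M. \<Sum>x<L. \<Sum>y<L. \<beta> k * cos (\<theta> k * (real x - real y)))"
          by (simp add: sum_distrib_left)
        also have "\<dots> = (\<Sum>x<L. \<Sum>k<M. \<Sum>y<L. \<beta> k * cos (\<theta> k * (real x - real y)))"
          by (rule sum.swap)
        also have "\<dots> = (\<Sum>x<L. \<Sum>y<L. w x y)"
          unfolding w_def by (rule sum.cong[OF refl sum.swap])
        finally show ?thesis .
      qed
      \<comment> \<open>The square is split along its diagonal, which both halves contain; the
        double counting is harmless because \<open>W\<close> is nonnegative.\<close>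
      also have "\<dots> \<le> (\<Sum>x<L. \<Sum>y<L. (if y \<le> x then W (x - y) else 0) + (if x \<le> y then W (y - x) else 0))"
      proof (intro sum_mono)
        fix x y assume "x \<in> {..<L}" "y \<in> {..<L}"
        then show "w x y \<le> (if y \<le> x then W (x - y) else 0) + (if x \<le> y then W (y - x) else 0)"
          using w[of y x] w[of x y] w_sym[of x y] by (auto simp: W_def)
      qed
      also have "\<dots> = 2 * (\<Sum>x<L. \<Sum>y<L. if y \<le> x then W (x - y) else 0)"
        by (simp add: sum.distrib) (subst sum.swap, simp)
      also have "\<dots> \<le> 2 * (\<Sum>x<L. \<Sum>l<L. W l)"
      proof -
        have "(\<Sum>y<L. if y \<le> x then W (x - y) else 0) \<le> (\<Sum>l<L. W l)" if "x < L" for x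
        proof -
          have "(\<Sum>y<L. if y \<le> x then W (x - y) else 0) = (\<Sum>y\<le>x. W (x - y))"
            using that by (simp add: sum.If_cases) (intro sum.cong, auto)
          also have "\<dots> = (\<Sum>l\<le>x. W l)" by (rule sum.nat_diff_reindex[of W "Suc x", simplified lessThan_Suc_atMost, simplified])
          also have "\<dots> \<le> (\<Sum>l<L. W l)"
            using that by (intro sum_mono2) (auto simp: W_def)
          finally show ?thesis .
        qed
        then have "(\<Sum>x<L. \<Sum>y<L. if y \<le> x then W (x - y) else 0) \<le> (\<Sum>x<L. \<Sum>l<L. W l)"
          by (meson lessThan_iff sum_mono)
        then show ?thesis by linarith
      qed
      finally have *: "\<beta> 0 * (real L)\<^sup>2 \<le> 2 * (real L * (\<Sum>l<L. W l))" by simp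
      \<comment> \<open>At frequency 0 all phases are 1, so \<open>F 0 = card A\<close>. The 3 from
        \<open>M = 3 * m\<close> and the 2 from the two halves of the square make the 6 in the
        conclusion.\<close>
      have "c ^ 4 * real m ^ 4 \<le> real (card A) ^ 4"
        using power_mono[OF c(2), of 4] c(1) by (simp add: power_mult_distrib)
      also have "\<dots> = F 0 ^ 4" by (simp add: F_def)
      finally have "c ^ 4 / 3 \<le> \<beta> 0"
        using m by (simp add: \<beta>_def D_def M_def field_simps eval_nat_numeral)
      then have "c ^ 4 / 3 * (real L)\<^sup>2 \<le> 2 * (real L * (\<Sum>l<L. W l))"
        using * by (meson mult_right_mono order_trans zero_le_power2)
      then show ?thesis using False by (simp add: power2_eq_square field_simps)
    qed simp
  qed
qed

section \<open>Compactness and the passage to an infinite window\<close>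

lemma bounded_sequences_convergent_subsequence:
  fixes x :: "nat \<Rightarrow> nat \<Rightarrow> 'a::heine_borel"
  assumes "\<And>j. j < J \<Longrightarrow> bounded (range (\<lambda>n. x n j))"
  shows "\<exists>r l. strict_mono (r :: nat \<Rightarrow> nat) \<and> (\<forall>j<J. (\<lambda>n. x (r n) j) \<longlonglongrightarrow> l j)"
  using assms
proof (induction J)
  case 0
  show ?case using strict_mono_id by auto
next
  case (Suc J)
  then obtain r l where r: "strict_mono (r :: nat \<Rightarrow> nat)" and l: "\<And>j. j < J \<Longrightarrow> (\<lambda>n. x (r n) j) \<longlonglongrightarrow> l j"
    by (metis less_SucI)
  have "bounded (range (\<lambda>n. x (r n) J))"
    by (rule bounded_subset[OF Suc.prems[of J]]) auto
  then obtain l' r' where r': "strict_mono (r' :: nat \<Rightarrow> nat)" and l': "((\<lambda>n. x (r n) J) \<circ> r') \<longlonglongrightarrow> l'"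
    using bounded_imp_convergent_subsequence by blast
  have "(\<lambda>n. x ((r \<circ> r') n) j) \<longlonglongrightarrow> (l(J := l')) j" if "j < Suc J" for j
  proof (cases "j = J")
    case True
    then show ?thesis using l' by (simp add: o_def)
  next
    case False
    then show ?thesis using LIMSEQ_subseq_LIMSEQ[OF l[of j] r'] that by (simp add: o_def)
  qed
  then show ?case using strict_mono_o[OF r r'] by blast
qed

text \<open>The finite lemma is applied to \<open>E \<inter> {..<m}\<close> with \<open>m\<close>
  growing, and a subsequence is chosen along which the \<open>J\<close> weights and bases converge.
  The finite functions \<open>W\<close> are not passed to the limit: a new \<open>W\<close> is read
  off from the limit polynomial, at the price of an additional \<open>\<delta>\<^sup>2\<close> in
  both estimates.\<close>

lemma bogolyubov:
  fixes E :: "nat set" and c \<delta> :: real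
  assumes E: "\<forall>m\<ge>m0. c * real m \<le> real (card (E \<inter> {..<m}))" and c: "c \<ge> 0" and \<delta>: "\<delta> > 0"
  obtains J :: nat and W :: "nat \<Rightarrow> real" and b :: "nat \<Rightarrow> real" and z :: "nat \<Rightarrow> complex"
  where "\<And>l. 0 \<le> W l"
    and "\<And>l. W l \<noteq> 0 \<Longrightarrow> \<exists>p\<in>E. \<exists>q\<in>E. \<exists>r\<in>E. \<exists>s\<in>E. l + p + q = r + s"
    and "\<And>l. cmod (of_real (W l) - (\<Sum>j<J. of_real (b j) * z j ^ l)) \<le> 2 * \<delta>\<^sup>2"
    and "\<And>j. j < J \<Longrightarrow> 0 \<le> b j" and "(\<Sum>j<J. b j) \<le> 1" and "\<And>j. j < J \<Longrightarrow> cmod (z j) = 1"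
    and "\<And>L. real L * (c ^ 4 / 6 - \<delta>\<^sup>2) \<le> (\<Sum>l<L. W l)"
proof -
  define J where "J = nat \<lceil>3 / \<delta>\<^sup>2\<rceil>"
  have J: "3 / \<delta>\<^sup>2 \<le> real J" unfolding J_def by linarith
  define m where "m n = Suc m0 + n" for n
  define good where "good n W x \<longleftrightarrow> (\<forall>l. 0 \<le> W l)
    \<and> (\<forall>l. W l \<noteq> 0 \<longrightarrow> (\<exists>p\<in>E. \<exists>q\<in>E. \<exists>r\<in>E. \<exists>s\<in>E. l + p + q = r + s))
    \<and> (\<forall>l<m n. cmod (of_real (W l) - (\<Sum>j<J. of_real (fst (x j)) * snd (x j) ^ l)) \<le> \<delta>\<^sup>2)
    \<and> (\<forall>j. 0 \<le> fst (x j)) \<and> (\<Sum>j<J. fst (x j)) \<le> 1 \<and> (\<forall>j. cmod (snd (x j)) = 1)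
    \<and> (\<forall>L\<le>m n. real L * (c ^ 4 / 6) \<le> (\<Sum>l<L. W l))"
    for n and W :: "nat \<Rightarrow> real" and x :: "nat \<Rightarrow> real \<times> complex"
  have "\<exists>W x. good n W x" for n
  proof -
    have mn: "m n > 0" "E \<inter> {..<m n} \<subseteq> {..<m n}" by (auto simp: m_def)
    have cn: "c * real (m n) \<le> real (card (E \<inter> {..<m n}))" by (rule E[rule_format]) (simp add: m_def)
    show ?thesis
    proof (rule bogolyubov_finite[OF mn \<delta> c cn J])
      fix W :: "nat \<Rightarrow> real" and b :: "nat \<Rightarrow> real" and z :: "nat \<Rightarrow> complex"
      assume *: "\<And>l. 0 \<le> W l"
        and near: "\<And>l. W l \<noteq> 0 \<Longrightarrow> \<exists>p\<in>E \<inter> {..<m n}. \<exists>q\<in>E \<inter> {..<m n}. \<exists>r\<in>E \<inter> {..<m n}. \<exists>s\<in>E \<inter> {..<m n}. l + p + q = r + s"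
        and **: "\<And>l. l < m n \<Longrightarrow> cmod (of_real (W l) - (\<Sum>j<J. of_real (b j) * z j ^ l)) \<le> \<delta>\<^sup>2"
        "\<And>j. 0 \<le> b j" "(\<Sum>j<J. b j) \<le> 1" "\<And>j. cmod (z j) = 1"
        "\<And>L. L \<le> m n \<Longrightarrow> real L * (c ^ 4 / 6) \<le> (\<Sum>l<L. W l)"
      have "\<exists>p\<in>E. \<exists>q\<in>E. \<exists>r\<in>E. \<exists>s\<in>E. l + p + q = r + s" if "W l \<noteq> 0" for l
        using near[OF that] by blast
      with * ** have "good n W (\<lambda>j. (b j, z j))" unfolding good_def by auto
      then show "\<exists>W x. good n W x" by blast
    qed
  qed
  then obtain V x where "\<And>n. good n (V n) (x n)" by metis
  then have V0: "\<And>n l. 0 \<le> V n l"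
    and VE: "\<And>n l. V n l \<noteq> 0 \<Longrightarrow> \<exists>p\<in>E. \<exists>q\<in>E. \<exists>r\<in>E. \<exists>s\<in>E. l + p + q = r + s"
    and VP: "\<And>n l. l < m n \<Longrightarrow> cmod (of_real (V n l) - (\<Sum>j<J. of_real (fst (x n j)) * snd (x n j) ^ l)) \<le> \<delta>\<^sup>2"
    and b0: "\<And>n j. 0 \<le> fst (x n j)" and b1: "\<And>n. (\<Sum>j<J. fst (x n j)) \<le> 1"
    and z1: "\<And>n j. cmod (snd (x n j)) = 1"
    and VL: "\<And>n L. L \<le> m n \<Longrightarrow> real L * (c ^ 4 / 6) \<le> (\<Sum>l<L. V n l)"
    unfolding good_def by blast+
  have "bounded (range (\<lambda>n. x n j))" if "j < J" for j
  proof -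
    have "fst (x n j) \<le> 1" for n
      using b1[of n] member_le_sum[of j "{..<J}" "\<lambda>j. fst (x n j)"] b0 that by simp
    then have "norm (x n j) \<le> 1 + 1" for n
      using norm_Pair_le[of "fst (x n j)" "snd (x n j)"] b0[of n j] z1[of n j] by (smt (verit) prod.collapse real_norm_def)
    then show ?thesis unfolding bounded_iff by blast
  qed
  from bounded_sequences_convergent_subsequence[of J x, OF this] obtain r y where r: "strict_mono (r :: nat \<Rightarrow> nat)"
    and y: "\<And>j. j < J \<Longrightarrow> (\<lambda>n. x (r n) j) \<longlonglongrightarrow> y j" by blast
  define b where "b j = fst (y j)" for j
  define z where "z j = snd (y j)" for j
  have b: "(\<lambda>n. fst (x (r n) j)) \<longlonglongrightarrow> b j" if "j < J" for j
    using tendsto_fst[OF y[OF that]] by (simp add: b_def)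
  have z: "(\<lambda>n. snd (x (r n) j)) \<longlonglongrightarrow> z j" if "j < J" for j
    using tendsto_snd[OF y[OF that]] by (simp add: z_def)
  define P where "P l = (\<Sum>j<J. of_real (b j) * z j ^ l)" for l
  have P: "(\<lambda>n. \<Sum>j<J. of_real (fst (x (r n) j)) * snd (x (r n) j) ^ l) \<longlonglongrightarrow> P l" for l
    unfolding P_def by (intro tendsto_sum tendsto_mult tendsto_of_real tendsto_power b z) auto
  define near where "near l \<longleftrightarrow> (\<exists>p\<in>E. \<exists>q\<in>E. \<exists>r\<in>E. \<exists>s\<in>E. l + p + q = r + s)" for l
  have large: "\<forall>\<^sub>F n in sequentially. l < m (r n)" for l
    using eventually_ge_at_top[of l]
  proof eventually_elim
    case (elim n)
    then show ?case using seq_suble[OF r, of n] by (simp add: m_def)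
  qed
  \<comment> \<open>Once \<open>l < m (r n)\<close>, the approximating polynomial lies within
    \<open>\<delta>\<^sup>2\<close> of a nonnegative real number, and these closed conditions
    survive the limit.\<close>
  have P_bounds: "\<bar>Im (P l)\<bar> \<le> \<delta>\<^sup>2" "- \<delta>\<^sup>2 \<le> Re (P l)" for l
  proof -
    have ev: "\<forall>\<^sub>F n in sequentially. \<bar>Im (\<Sum>j<J. of_real (fst (x (r n) j)) * snd (x (r n) j) ^ l)\<bar> \<le> \<delta>\<^sup>2
      \<and> - \<delta>\<^sup>2 \<le> Re (\<Sum>j<J. of_real (fst (x (r n) j)) * snd (x (r n) j) ^ l)"
      using large[of l]
    proof eventually_elim
      case (elim n)
      define p where "p = (\<Sum>j<J. of_real (fst (x (r n) j)) * snd (x (r n) j) ^ l)"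
      have "cmod (of_real (V (r n) l) - p) \<le> \<delta>\<^sup>2" using VP[OF elim] by (simp add: p_def)
      then show ?case
        using abs_Re_le_cmod[of "of_real (V (r n) l) - p"] abs_Im_le_cmod[of "of_real (V (r n) l) - p"] V0[of "r n" l]
        unfolding p_def[symmetric] by simp
    qed
    show "\<bar>Im (P l)\<bar> \<le> \<delta>\<^sup>2"
      by (rule tendsto_upperbound[OF tendsto_rabs[OF tendsto_Im[OF P]]]) (use ev in \<open>auto elim: eventually_mono\<close>)
    show "- \<delta>\<^sup>2 \<le> Re (P l)"
      by (rule tendsto_lowerbound[OF tendsto_Re[OF P]]) (use ev in \<open>auto elim: eventually_mono\<close>)
  qed
  have P_far: "cmod (P l) \<le> \<delta>\<^sup>2" if "\<not> near l" for l
  proof (rule tendsto_upperbound[OF tendsto_norm[OF P]])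
    show "\<forall>\<^sub>F n in sequentially. cmod (\<Sum>j<J. of_real (fst (x (r n) j)) * snd (x (r n) j) ^ l) \<le> \<delta>\<^sup>2"
      using large[of l]
    proof eventually_elim
      case (elim n)
      have "V (r n) l = 0" using VE that unfolding near_def by blast
      then show ?case using VP[OF elim] by (simp add: norm_minus_commute)
    qed
  qed simp
  \<comment> \<open>The positive part of \<open>Re (P l)\<close> differs from it by at most
    \<open>\<delta>\<^sup>2\<close>, and the imaginary part costs another
    \<open>\<delta>\<^sup>2\<close>. Where \<open>near l\<close> fails, \<open>P l\<close> itself is
    small, so the value 0 is accurate and the support condition holds by construction.\<close>
  define W where "W l = (if near l then max 0 (Re (P l)) else 0)" for l
  show ?thesis
  proof
    show "0 \<le> W l" for l by (simp add: W_def)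
    show "\<exists>p\<in>E. \<exists>q\<in>E. \<exists>r\<in>E. \<exists>s\<in>E. l + p + q = r + s" if "W l \<noteq> 0" for l
      using that unfolding W_def near_def by (auto split: if_splits)
    show "cmod (of_real (W l) - (\<Sum>j<J. of_real (b j) * z j ^ l)) \<le> 2 * \<delta>\<^sup>2" for l
    proof (cases "near l")
      case True
      have "cmod (of_real (W l) - P l) \<le> \<bar>Re (of_real (W l) - P l)\<bar> + \<bar>Im (of_real (W l) - P l)\<bar>"
        by (rule cmod_le)
      also have "\<dots> \<le> 2 * \<delta>\<^sup>2" using P_bounds[of l] True by (simp add: W_def)
      finally show ?thesis by (simp add: P_def)
    next
      case False
      then show ?thesis using P_far[of l] zero_le_power2[of \<delta>] unfolding W_def P_def[symmetric] by (smt (verit) diff_0 norm_minus_cancel of_real_0)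
    qed
    show "0 \<le> b j" if "j < J" for j
      by (rule tendsto_lowerbound[OF b[OF that]]) (use b0 in auto)
    have "(\<lambda>n. \<Sum>j<J. fst (x (r n) j)) \<longlonglongrightarrow> (\<Sum>j<J. b j)"
      by (intro tendsto_sum b) auto
    then show "(\<Sum>j<J. b j) \<le> 1"
      by (rule tendsto_upperbound) (use b1 in auto)
    show "cmod (z j) = 1" if "j < J" for j
      using tendsto_norm[OF z[OF that]] unfolding z1 by (simp add: tendsto_const_iff)
    show "real L * (c ^ 4 / 6 - \<delta>\<^sup>2) \<le> (\<Sum>l<L. W l)" for L
    proof -
      \<comment> \<open>Adding \<open>\<delta>\<^sup>2\<close> at the points with
        \<open>near l\<close> turns the summand into an upper bound for \<open>V (r n) l\<close>.
        With \<open>L\<close> fixed, the finite estimate holds for all large \<open>n\<close>, so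
        the limit gives a bound for every \<open>L\<close>.\<close>
      have lim: "(\<lambda>n. \<Sum>l<L. if near l then Re (\<Sum>j<J. of_real (fst (x (r n) j)) * snd (x (r n) j) ^ l) + \<delta>\<^sup>2 else 0)
        \<longlonglongrightarrow> (\<Sum>l<L. if near l then Re (P l) + \<delta>\<^sup>2 else 0)"
      proof (intro tendsto_sum)
        fix l
        show "(\<lambda>n. if near l then Re (\<Sum>j<J. of_real (fst (x (r n) j)) * snd (x (r n) j) ^ l) + \<delta>\<^sup>2 else 0)
          \<longlonglongrightarrow> (if near l then Re (P l) + \<delta>\<^sup>2 else 0)"
          using tendsto_add[OF tendsto_Re[OF P[of l]] tendsto_const[of "\<delta>\<^sup>2"]]
          by (cases "near l") (simp_all only: if_True if_False tendsto_const)
      qed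
      have "real L * (c ^ 4 / 6) \<le> (\<Sum>l<L. if near l then Re (P l) + \<delta>\<^sup>2 else 0)"
      proof (rule tendsto_lowerbound[OF lim])
        show "\<forall>\<^sub>F n in sequentially. real L * (c ^ 4 / 6)
          \<le> (\<Sum>l<L. if near l then Re (\<Sum>j<J. of_real (fst (x (r n) j)) * snd (x (r n) j) ^ l) + \<delta>\<^sup>2 else 0)"
          using large[of L]
        proof eventually_elim
          case (elim n)
          have "real L * (c ^ 4 / 6) \<le> (\<Sum>l<L. V (r n) l)" using VL elim by simp
          also have "\<dots> \<le> (\<Sum>l<L. if near l then Re (\<Sum>j<J. of_real (fst (x (r n) j)) * snd (x (r n) j) ^ l) + \<delta>\<^sup>2 else 0)"
          proof (intro sum_mono)
            fix l assume "l \<in> {..<L}"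
            then have l: "l < m (r n)" using elim by simp
            define p where "p = (\<Sum>j<J. of_real (fst (x (r n) j)) * snd (x (r n) j) ^ l)"
            have "V (r n) l \<le> Re p + \<delta>\<^sup>2"
              using abs_Re_le_cmod[of "of_real (V (r n) l) - p"] VP[OF l] unfolding p_def[symmetric] by simp
            moreover have "V (r n) l = 0" if "\<not> near l" using VE that unfolding near_def by blast
            ultimately show "V (r n) l \<le> (if near l then Re (\<Sum>j<J. of_real (fst (x (r n) j)) * snd (x (r n) j) ^ l) + \<delta>\<^sup>2 else 0)"
              unfolding p_def by auto
          qed
          finally show ?case .
        qed
      qed simp
      also have "\<dots> \<le> (\<Sum>l<L. W l + \<delta>\<^sup>2)" by (intro sum_mono) (auto simp: W_def)
      also have "\<dots> = (\<Sum>l<L. W l) + real L * \<delta>\<^sup>2" by (simp add: sum.distrib)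
      finally show ?thesis by (simp add: right_diff_distrib)
    qed
  qed
qed

section \<open>Almost periods\<close>

interpretation complex_scaling: vector_space "scaleC :: complex \<Rightarrow> 'a \<Rightarrow> 'a::complex_vector"
  by unfold_locales (simp_all add: scaleC_add_right scaleC_add_left scaleC_scaleC scaleC_one)

lemma bounded_linear_scaleC_left: "bounded_linear (\<lambda>a. a *\<^sub>C (x :: 'a::complex_normed_vector))"
proof (rule bounded_linear_intro[where K = "norm x"])
  fix r a
  have "(r *\<^sub>R a) *\<^sub>C x = (complex_of_real r * a) *\<^sub>C x" by (simp only: scaleR_conv_of_real)
  also have "\<dots> = r *\<^sub>R (a *\<^sub>C x)" by (simp only: scaleC_scaleC scaleR_scaleC)
  finally show "(r *\<^sub>R a) *\<^sub>C x = r *\<^sub>R (a *\<^sub>C x)" .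
qed (simp_all add: scaleC_add_left norm_scaleC)

lemma bounded_linear_scaleC_right: "bounded_linear (\<lambda>x :: 'a::complex_normed_vector. a *\<^sub>C x)"
  by (rule bounded_linear_intro[where K = "cmod a"])
    (simp_all add: scaleC_add_right scaleR_scaleC scaleC_scaleC norm_scaleC mult_ac)

text \<open>A variant of \<open>periods\<close> in which \<open>s\<close> may be 0 or, also on the
  half line, negative: the estimate is asked only where both points lie in \<open>I\<close>. Such
  numbers are closed under negation and addition, with errors adding up, as the combinations
  \<open>r + s - p - q\<close> from Bogolyubov's lemma require.\<close>

definition translation_close :: "real set \<Rightarrow> (real \<Rightarrow> 'a::real_normed_vector) \<Rightarrow> real \<Rightarrow> real \<Rightarrow> bool"
  where "translation_close I f e s \<longleftrightarrow> (\<forall>t\<in>I. t + s \<in> I \<longrightarrow> norm (f (t + s) - f t) \<le> e)"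

lemma translation_closeD:
  "translation_close I f e s \<Longrightarrow> t \<in> I \<Longrightarrow> t + s \<in> I \<Longrightarrow> norm (f (t + s) - f t) \<le> e"
  by (simp add: translation_close_def)

lemma translation_close_minus: "translation_close I f e (- s)" if "translation_close I f e s"
  unfolding translation_close_def
proof (intro ballI impI)
  fix t assume "t \<in> I" "t + - s \<in> I"
  then show "norm (f (t + - s) - f t) \<le> e"
    using translation_closeD[OF that, of "t - s"] by (simp add: norm_minus_commute)
qed

lemma translation_close_add:
  assumes I: "I = UNIV \<or> I = {0..}" and a: "translation_close I f a s" and b: "translation_close I f b s'"
  shows "translation_close I f (a + b) (s + s')"
  unfolding translation_close_def
proof (intro ballI impI)
  fix t assume t: "t \<in> I" "t + (s + s') \<in> I"
  show "norm (f (t + (s + s')) - f t) \<le> a + b"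
  proof (cases "t + s \<in> I")
    case True
    then show ?thesis
      using translation_closeD[OF a t(1)] translation_closeD[OF b, of "t + s"] t
        norm_triangle_ineq[of "f (t + s + s') - f (t + s)" "f (t + s) - f t"] by (simp add: add.assoc)
  next
    \<comment> \<open>On the half line the two translations may only be admissible in the other order.\<close>
    case False
    then have "t + s' \<in> I" using I t by auto
    then show ?thesis
      using translation_closeD[OF b t(1)] translation_closeD[OF a, of "t + s'"] t
        norm_triangle_ineq[of "f (t + s' + s) - f (t + s')" "f (t + s') - f t"] by (simp add: add_ac)
  qed
qed

text \<open>\<open>I\<close> is closed under addition, so \<open>f (t + \<tau>)\<close> only
  involves values on \<open>I\<close>. Functions can therefore be cut off to 0 outside
  \<open>I\<close> or replaced by formulas that make sense on the whole line.\<close>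

lemma almost_periodic_cong:
  assumes I: "I = UNIV \<or> I = {0..}" and eq: "\<And>t. t \<in> I \<Longrightarrow> f t = g t"
  shows "almost_periodic I f \<longleftrightarrow> almost_periodic I g"
proof -
  have "periods I f e = periods I g e" for e
  proof -
    have "f (t + \<tau>) - f t = g (t + \<tau>) - g t" if "t \<in> I" "\<tau> \<in> I" for t \<tau>
      using that I eq by auto
    then show ?thesis by (auto simp: periods_def)
  qed
  moreover have "continuous_on I f \<longleftrightarrow> continuous_on I g" using eq by (intro continuous_on_cong) auto
  ultimately show ?thesis by (simp add: almost_periodic_def)
qed

lemma almost_anti_periodic_cong:
  assumes I: "I = UNIV \<or> I = {0..}" and eq: "\<And>t. t \<in> I \<Longrightarrow> f t = g t"
  shows "almost_anti_periodic I f \<longleftrightarrow> almost_anti_periodic I g"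
proof -
  have "antiperiods I f e = antiperiods I g e" for e
  proof -
    have "f (t + \<tau>) + f t = g (t + \<tau>) + g t" if "t \<in> I" "\<tau> \<in> I" for t \<tau>
      using that I eq by auto
    then show ?thesis by (auto simp: antiperiods_def)
  qed
  moreover have "continuous_on I f \<longleftrightarrow> continuous_on I g" using eq by (intro continuous_on_cong) auto
  ultimately show ?thesis by (simp add: almost_anti_periodic_def)
qed

lemma almost_periodic_bounded:
  fixes f :: "real \<Rightarrow> 'a::complex_banach"
  assumes I: "I = UNIV \<or> I = {0..}" and f: "almost_periodic I f"
  obtains B where "B > 0" "\<And>t. t \<in> I \<Longrightarrow> norm (f t) \<le> B"
proof -
  define g where "g t = (if t \<in> I then f t else 0)" for t
  have "almost_periodic I g"
    using f almost_periodic_cong[OF I, of f g] by (simp add: g_def)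
  then have "g \<in> AP I" by (simp add: AP_def functions_on_def g_def)
  then obtain B where B: "\<And>t. t \<in> I \<Longrightarrow> norm (g t) \<le> B"
    using AP_bounded[OF I] unfolding bounded_iff by blast
  show ?thesis
  proof
    show "max B 1 > 0" by simp
    show "norm (f t) \<le> max B 1" if "t \<in> I" for t using B[OF that] that by (simp add: g_def)
  qed
qed

lemma translation_close_relatively_dense:
  assumes I: "I = UNIV \<or> I = {0..}" and f: "almost_periodic I f" and e: "e > 0"
  obtains l where "l > 0" "\<And>t. t \<in> I \<Longrightarrow> \<exists>\<tau>. translation_close I f e \<tau> \<and> \<tau> \<le> t \<and> t \<le> \<tau> + l"
proof -
  have "relatively_dense I (periods I f e)"
    using f e by (auto simp: almost_periodic_def)
  then obtain l where l: "l > 0"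
    and meets: "\<And>a. {a..a + l} \<subseteq> I \<Longrightarrow> {a..a + l} \<inter> periods I f e \<noteq> {}"
    unfolding relatively_dense_def by blast
  show ?thesis
  proof
    fix t assume t: "t \<in> I"
    show "\<exists>\<tau>. translation_close I f e \<tau> \<and> \<tau> \<le> t \<and> t \<le> \<tau> + l"
    proof (cases "{t - l..t - l + l} \<subseteq> I")
      case True
      from meets[OF this] obtain \<tau> where "\<tau> \<in> periods I f e" "t - l \<le> \<tau>" "\<tau> \<le> t" by auto
      then show ?thesis by (intro exI[of _ \<tau>]) (auto simp: periods_def translation_close_def)
    next
      case False
      \<comment> \<open>This happens only on the half line, near its end point, where the window
        would leave \<open>I\<close>; the trivial translation 0 serves instead.\<close>
      then have "0 \<le> t" "t \<le> l" using I t by auto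
      then show ?thesis using e by (intro exI[of _ 0]) (auto simp: translation_close_def)
    qed
  qed (fact l)
qed

text \<open>Uniform continuity of \<open>f\<close>, phrased as closeness under small translations.
  An almost period moves \<open>t\<close> into \<open>{0..l + 1}\<close>, where compactness applies,
  and the error is split into three parts.\<close>

lemma translation_close_small:
  assumes I: "I = UNIV \<or> I = {0..}" and f: "almost_periodic I f" and e: "e > 0"
  obtains \<rho> where "\<rho> > 0" "\<And>s. \<bar>s\<bar> \<le> \<rho> \<Longrightarrow> translation_close I f e s"
proof -
  obtain l where l: "l > 0"
    and dense: "\<And>t. t \<in> I \<Longrightarrow> \<exists>\<tau>. translation_close I f (e / 3) \<tau> \<and> \<tau> \<le> t \<and> t \<le> \<tau> + l"
    using translation_close_relatively_dense[OF I f, of "e / 3"] e by auto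
  have sub: "{0..l + 1} \<subseteq> I" using I by auto
  then have "continuous_on {0..l + 1} f"
    using f by (auto simp: almost_periodic_def intro: continuous_on_subset)
  then have "uniformly_continuous_on {0..l + 1} f"
    by (simp add: compact_uniformly_continuous)
  then obtain d where d: "d > 0" "\<And>x y. x \<in> {0..l + 1} \<Longrightarrow> y \<in> {0..l + 1} \<Longrightarrow> dist y x < d \<Longrightarrow> dist (f y) (f x) < e / 3"
    using e unfolding uniformly_continuous_on_def by (metis divide_pos_pos zero_less_numeral)
  define \<rho> where "\<rho> = min 1 (d / 2)"
  have pos: "translation_close I f e s" if s: "0 \<le> s" "s \<le> \<rho>" for s
    unfolding translation_close_def
  proof (intro ballI impI)
    fix t assume t: "t \<in> I" "t + s \<in> I"
    obtain \<tau> where \<tau>: "translation_close I f (e / 3) \<tau>" "\<tau> \<le> t" "t \<le> \<tau> + l" using dense[OF t(1)] by blast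
    have u: "t - \<tau> \<in> {0..l + 1}" "t - \<tau> + s \<in> {0..l + 1}" using \<tau> s by (auto simp: \<rho>_def)
    then have uI: "t - \<tau> \<in> I" "t - \<tau> + s \<in> I" using sub by blast+
    have "norm (f (t - \<tau> + s) - f (t - \<tau>)) \<le> e / 3"
      using d(2)[OF u] s d(1) by (simp add: \<rho>_def dist_norm)
    moreover have "norm (f t - f (t - \<tau>)) \<le> e / 3"
      using translation_closeD[OF \<tau>(1) uI(1)] t by simp
    moreover have "norm (f (t + s) - f (t - \<tau> + s)) \<le> e / 3"
      using translation_closeD[OF \<tau>(1) uI(2)] t by simp
    ultimately show "norm (f (t + s) - f t) \<le> e"
      using norm_triangle_ineq[of "f (t + s) - f (t - \<tau> + s)" "f (t - \<tau> + s) - f (t - \<tau>)"]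
        norm_triangle_ineq4[of "f (t + s) - f (t - \<tau>)" "f t - f (t - \<tau>)"] by simp
  qed
  show ?thesis
  proof
    show "\<rho> > 0" using d by (simp add: \<rho>_def)
    show "translation_close I f e s" if "\<bar>s\<bar> \<le> \<rho>" for s
      using pos[of s] translation_close_minus[OF pos[of "- s"]] that by (cases "s \<ge> 0") auto
  qed
qed

text \<open>A late grid point lies at most \<open>l\<close> above an almost period; moved down by at
  most \<open>n\<close> steps of length \<open>\<rho>\<close> it is less than \<open>\<rho>\<close>
  above it, hence an almost period itself. So \<open>n + 1\<close> translates cover all late grid
  points. The constants are fixed before \<open>q\<close>, since the mesh will be chosen in terms of
  \<open>c\<close>.\<close>

lemma translation_close_density:
  assumes I: "I = UNIV \<or> I = {0..}" and f: "almost_periodic I f" and e: "e > 0"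
  obtains c \<rho> where "c > 0" "\<rho> > 0"
    "\<And>q. q > 0 \<Longrightarrow> \<exists>m0. \<forall>m\<ge>m0. c * real m
        \<le> real (card ({j. translation_close I f e (real j * (\<rho> / real q))} \<inter> {..<m}))"
proof -
  obtain l where l: "l > 0"
    and dense: "\<And>t. t \<in> I \<Longrightarrow> \<exists>\<tau>. translation_close I f (e / 2) \<tau> \<and> \<tau> \<le> t \<and> t \<le> \<tau> + l"
    using translation_close_relatively_dense[OF I f, of "e / 2"] e by auto
  obtain \<rho> where \<rho>: "\<rho> > 0" and small: "\<And>s. \<bar>s\<bar> \<le> \<rho> \<Longrightarrow> translation_close I f (e / 2) s"
    using translation_close_small[OF I f, of "e / 2"] e by auto
  define n where "n = nat \<lceil>l / \<rho>\<rceil>"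
  show ?thesis
  proof
    show "1 / (2 * real (Suc n)) > 0" by simp
    show "\<rho> > 0" by fact
    fix q :: nat assume q: "q > 0"
    define h where "h = \<rho> / real q"
    have h: "h > 0" using \<rho> q by (simp add: h_def)
    define E where "E = {j. translation_close I f e (real j * h)}"
    define K where "K = nat \<lceil>l / h\<rceil>"
    \<comment> \<open>The number of translates does not depend on \<open>q\<close>, so the density survives refining the grid.\<close>
    have cover: "{K..<m} \<subseteq> (\<Union>i\<in>{..n}. (\<lambda>j. j + i * q) ` (E \<inter> {..<m}))" for m
    proof
      fix x assume x: "x \<in> {K..<m}"
      then have "l / h \<le> real x" unfolding K_def by simp
      then have lx: "l \<le> real x * h" using h by (simp add: field_simps)
      then have "real x * h \<in> I" using I l by auto
      then obtain \<tau> where \<tau>: "translation_close I f (e / 2) \<tau>" "\<tau> \<le> real x * h" "real x * h \<le> \<tau> + l"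
        using dense by blast
      define u where "u = (real x * h - \<tau>) / \<rho>"
      have u: "0 \<le> u" "u \<le> l / \<rho>" using \<tau> \<rho> by (auto simp: u_def divide_right_mono)
      define i where "i = nat \<lfloor>u\<rfloor>"
      have i: "real i \<le> u" "u < real i + 1" using u(1) unfolding i_def by linarith+
      have "i \<le> n" unfolding i_def n_def using u(2) by linarith
      have v: "real i * \<rho> \<le> real x * h - \<tau>" "real x * h - \<tau> < (real i + 1) * \<rho>"
        using i \<rho> by (auto simp: u_def field_simps)
      \<comment> \<open>Since \<open>i * \<rho> \<le> x * h - \<tau> \<le> l \<le> x * h\<close>,
        the natural number subtraction \<open>x - i * q\<close> is not truncated.\<close>
      then have "real i * \<rho> \<le> real x * h" using \<tau>(3) lx by linarith
      then have "real (i * q) * h \<le> real x * h" using q by (simp add: h_def)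
      then have iq: "i * q \<le> x" using h by (metis mult_le_cancel_right_pos of_nat_le_iff)
      have "translation_close I f (e / 2 + e / 2) (\<tau> + (real x * h - \<tau> - real i * \<rho>))"
        by (rule translation_close_add[OF I \<tau>(1) small]) (use v in \<open>simp add: algebra_simps\<close>)
      moreover have "\<tau> + (real x * h - \<tau> - real i * \<rho>) = real (x - i * q) * h"
        using iq q by (simp add: of_nat_diff h_def field_simps)
      ultimately have "x - i * q \<in> E" by (simp add: E_def)
      then have "x \<in> (\<lambda>j. j + i * q) ` (E \<inter> {..<m})"
        using iq x by (intro image_eqI[of _ _ "x - i * q"]) auto
      then show "x \<in> (\<Union>i\<in>{..n}. (\<lambda>j. j + i * q) ` (E \<inter> {..<m}))" using \<open>i \<le> n\<close> by blast
    qed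
    have "1 / (2 * real (Suc n)) * real m \<le> real (card (E \<inter> {..<m}))" if m: "m \<ge> 2 * K" for m
    proof -
      have "m - K = card {K..<m}" by simp
      also have "\<dots> \<le> card (\<Union>i\<in>{..n}. (\<lambda>j. j + i * q) ` (E \<inter> {..<m}))"
        by (rule card_mono[OF _ cover]) auto
      also have "\<dots> \<le> (\<Sum>i\<le>n. card ((\<lambda>j. j + i * q) ` (E \<inter> {..<m})))"
        by (rule card_UN_le) simp
      also have "\<dots> \<le> (\<Sum>i\<le>n. card (E \<inter> {..<m}))" by (intro sum_mono card_image_le) auto
      finally have "m - K \<le> Suc n * card (E \<inter> {..<m})" by simp
      then have "real m / 2 \<le> real (Suc n) * real (card (E \<inter> {..<m}))"
proof -
        have "real (m - K) \<le> real (Suc n) * real (card (E \<inter> {..<m}))"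
          using \<open>m - K \<le> _\<close> by (metis of_nat_le_iff of_nat_mult)
        moreover have "real m / 2 \<le> real (m - K)" using m by (simp add: of_nat_diff)
        ultimately show ?thesis by linarith
      qed
      then show ?thesis by (simp add: field_simps)
    qed
    then show "\<exists>m0. \<forall>m\<ge>m0. 1 / (2 * real (Suc n)) * real m
        \<le> real (card ({j. translation_close I f e (real j * (\<rho> / real q))} \<inter> {..<m}))"
      unfolding E_def h_def by blast
  qed
qed

text \<open>The chord has squared length \<open>2 - 2 * cos x\<close>, and the cosine decreases on
  \<open>{0..pi}\<close>.\<close>

lemma cmod_cis_minus_one_mono:
  assumes "\<bar>a\<bar> \<le> \<bar>b\<bar>" "\<bar>b\<bar> \<le> pi"
  shows "cmod (cis a - 1) \<le> cmod (cis b - 1)"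
proof -
  have sq: "(cmod (cis x - 1))\<^sup>2 = 2 - 2 * cos \<bar>x\<bar>" for x
  proof -
    have "(cmod (cis x - 1))\<^sup>2 = (cos x - 1)\<^sup>2 + (sin x)\<^sup>2" by (simp add: cmod_power2)
    also have "\<dots> = 2 - 2 * cos x" using sin_cos_squared_add[of x] by (simp add: power2_diff)
    finally show ?thesis by simp
  qed
  have "cos \<bar>b\<bar> \<le> cos \<bar>a\<bar>" using assms by (intro cos_monotone_0_pi_le) auto
  then have "(cmod (cis a - 1))\<^sup>2 \<le> (cmod (cis b - 1))\<^sup>2" unfolding sq by simp
  then show ?thesis by (rule power2_le_imp_le) simp
qed

section \<open>Approximation by trigonometric polynomials\<close>

lemma norm_average_le:
  fixes g :: "nat \<Rightarrow> 'a::real_normed_vector"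
  assumes "\<And>l. norm (g l) \<le> u l"
  shows "norm ((1 / real L) *\<^sub>R (\<Sum>l<L. g l)) \<le> (1 / real L) * (\<Sum>l<L. u l)"
  using sum_norm_le[of "{..<L}" g u] assms by (simp add: divide_right_mono)

text \<open>Moving \<open>t\<close> by \<open>h\<close> shifts the sum by one index, so
  \<open>A L\<close> is multiplied by \<open>inverse z\<close> up to a boundary term
  \<open>2 * B / L\<close>. An average \<open>A L 0\<close> that is not small forces
  \<open>cis (\<omega> * s)\<close> to be near 1 at almost periods \<open>s\<close>; bounding the
  product \<open>cmod (cis (\<omega> * s) - 1) * norm (A L 0)\<close> avoids a case distinction. An
  almost period then moves \<open>t\<close> to a bounded set, where it is compared with 0 along the
  grid.\<close>

lemma twisted_average_almost_character:
  fixes f :: "real \<Rightarrow> 'a::complex_banach"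
  assumes I: "I = UNIV \<or> I = {0..}" and f: "almost_periodic I f" and e: "e > 0" and h: "h > 0"
    and small: "\<And>s. \<bar>s\<bar> \<le> h \<Longrightarrow> translation_close I f e s" and z: "cmod z = 1"
  defines "A \<equiv> \<lambda>L t. (1 / real L) *\<^sub>R (\<Sum>l<L. z ^ l *\<^sub>C f (t + real l * h))"
  shows "\<exists>\<omega>. \<forall>\<^sub>F L in sequentially. \<forall>t\<in>I. norm (A L t - cis (\<omega> * t) *\<^sub>C A L 0) \<le> 13 * e"
proof -
  obtain B where B: "B > 0" "\<And>t. t \<in> I \<Longrightarrow> norm (f t) \<le> B" using almost_periodic_bounded[OF I f] by blast
  have I0: "0 \<in> I" using I by auto
  have I_add: "t + s \<in> I" if "t \<in> I" "0 \<le> s" for t s using that I by auto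
  have z0: "z \<noteq> 0" using z by auto
  \<comment> \<open>With the principal argument, \<open>\<bar>\<omega> * h\<bar> \<le> pi\<close>,
    so \<open>cis (\<omega> * r)\<close> for \<open>r\<close> between 0 and \<open>h\<close> is no
    farther from 1 than \<open>inverse z\<close>.\<close>
  define \<omega> where "\<omega> = - Arg z / h"
  have cis_h: "cis (\<omega> * h) = inverse z"
  proof -
    have "cis (Arg z) = z" using z z0 by (simp add: cis_Arg sgn_eq)
    then have "inverse z = cis (- Arg z)" by (metis cis_inverse)
    then show ?thesis using h by (simp add: \<omega>_def)
  qed
  have cis_kh: "cis (\<omega> * (real k * h)) = inverse z ^ k" for k
    unfolding cis_h[symmetric] by (simp add: Complex.DeMoivre mult_ac)
  have iz: "cmod (inverse z) = 1" using z by (simp add: norm_inverse)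
  have cis_r: "cmod (cis (\<omega> * r) - 1) \<le> cmod (inverse z - 1)" if "0 \<le> r" "r \<le> h" for r
    unfolding cis_h[symmetric]
  proof (rule cmod_cis_minus_one_mono)
    show "\<bar>\<omega> * r\<bar> \<le> \<bar>\<omega> * h\<bar>" using that by (simp add: abs_mult mult_left_mono)
    show "\<bar>\<omega> * h\<bar> \<le> pi" using h mpi_less_Arg[of z] Arg_le_pi[of z] by (simp add: \<omega>_def abs_le_iff)
  qed
  have shift1: "norm (A L (t + h) - inverse z *\<^sub>C A L t) \<le> 2 * B / real L" if t: "t \<in> I" and L: "L > 0" for L t
  proof -
    define g where "g l = z ^ l *\<^sub>C f (t + real l * h)" for l
    have "z *\<^sub>C (\<Sum>l<L. z ^ l *\<^sub>C f (t + h + real l * h)) = (\<Sum>l<L. g (Suc l))"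
      by (simp add: complex_scaling.scale_sum_right g_def scaleC_scaleC algebra_simps)
    moreover have "z *\<^sub>C A L (t + h) = (1 / real L) *\<^sub>R (z *\<^sub>C (\<Sum>l<L. z ^ l *\<^sub>C f (t + h + real l * h)))"
      by (simp only: A_def scaleR_scaleC scaleC_scaleC mult.commute)
    moreover have "A L t = (1 / real L) *\<^sub>R (\<Sum>l<L. g l)" by (simp only: A_def g_def)
    ultimately have "z *\<^sub>C A L (t + h) - A L t = (1 / real L) *\<^sub>R ((\<Sum>l<L. g (Suc l)) - (\<Sum>l<L. g l))"
      by (simp only: scaleR_diff_right)
    also have "\<dots> = (1 / real L) *\<^sub>R (g L - g 0)"
      by (simp add: sum_lessThan_telescope flip: sum_subtractf)
    finally have eq: "z *\<^sub>C A L (t + h) - A L t = (1 / real L) *\<^sub>R (g L - g 0)" .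
    have "norm (g l) \<le> B" for l
      using B(2)[of "t + real l * h"] I_add[OF t, of "real l * h"] h z
      by (simp add: g_def norm_scaleC norm_power)
    then have "norm (g L - g 0) \<le> 2 * B"
      using norm_triangle_ineq4[of "g L" "g 0"] by (smt (verit))
    then have "norm (z *\<^sub>C A L (t + h) - A L t) \<le> 2 * B / real L"
      unfolding eq using L by (simp add: divide_right_mono)
    moreover have "A L (t + h) - inverse z *\<^sub>C A L t = inverse z *\<^sub>C (z *\<^sub>C A L (t + h) - A L t)"
      using z0 by (simp add: complex_scaling.scale_right_diff_distrib scaleC_scaleC scaleC_one)
    ultimately show ?thesis by (simp add: norm_scaleC iz)
  qed
  have shift: "norm (A L (t + real k * h) - inverse z ^ k *\<^sub>C A L t) \<le> real k * (2 * B / real L)"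
    if t: "t \<in> I" and L: "L > 0" for L t k
  proof (induction k)
    case 0
    show ?case by (simp add: scaleC_one)
  next
    case (Suc k)
    have "A L (t + real (Suc k) * h) - inverse z ^ Suc k *\<^sub>C A L t
      = (A L (t + real k * h + h) - inverse z *\<^sub>C A L (t + real k * h))
        + inverse z *\<^sub>C (A L (t + real k * h) - inverse z ^ k *\<^sub>C A L t)"
      by (simp add: complex_scaling.scale_right_diff_distrib scaleC_scaleC algebra_simps)
    also have "norm \<dots> \<le> 2 * B / real L + real k * (2 * B / real L)"
      using shift1[OF I_add[OF t, of "real k * h"] L] h Suc
      by (intro order_trans[OF norm_triangle_ineq] add_mono) (simp_all add: norm_scaleC iz)
    finally show ?case by (simp add: algebra_simps add_divide_distrib)
  qed
  have close: "norm (A L (t + s) - A L t) \<le> d"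
    if s: "translation_close I f d s" and t: "t \<in> I" "t + s \<in> I" and L: "L > 0" for L t s d
  proof -
    have "A L (t + s) - A L t = (1 / real L) *\<^sub>R (\<Sum>l<L. z ^ l *\<^sub>C (f (t + real l * h + s) - f (t + real l * h)))"
      by (simp add: A_def complex_scaling.scale_right_diff_distrib sum_subtractf scaleR_diff_right add_ac)
    also have "norm \<dots> \<le> (1 / real L) * (\<Sum>l<L. d)"
    proof -
      have "norm (z ^ l *\<^sub>C (f (t + real l * h + s) - f (t + real l * h))) \<le> d" for l
        using translation_closeD[OF s I_add[OF t(1), of "real l * h"]] I_add[OF t(2), of "real l * h"] h z
        by (simp add: norm_scaleC norm_power add_ac)
      then show ?thesis by (rule norm_average_le)
    qed
    also have "\<dots> = d" using L by simp
    finally show ?thesis .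
  qed
  have diff: "norm (a *\<^sub>C A L 0 - b *\<^sub>C A L 0) = cmod (a - b) * norm (A L 0)" for a b L
    by (simp add: norm_scaleC flip: complex_scaling.scale_left_diff_distrib)
  \<comment> \<open>A step of length \<open>h\<close> changes \<open>A L\<close> by at most
    \<open>e\<close>, because \<open>h\<close> is a small translation, but it also acts nearly as
    multiplication by \<open>inverse z\<close>.\<close>
  have z_near: "cmod (inverse z - 1) * norm (A L 0) \<le> e + 2 * B / real L" if L: "L > 0" for L
  proof -
    have "norm (inverse z *\<^sub>C A L 0 - 1 *\<^sub>C A L 0) \<le> norm (A L (0 + h) - A L 0) + norm (A L (0 + h) - inverse z *\<^sub>C A L 0)"
      using norm_triangle_ineq4[of "A L (0 + h) - A L 0" "A L (0 + h) - inverse z *\<^sub>C A L 0"]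
      by (simp add: scaleC_one)
    also have "\<dots> \<le> e + 2 * B / real L"
      using close[OF small[of h] I0 _ L] I_add[OF I0, of h] h shift1[OF I0 L] by (intro add_mono) auto
    finally show ?thesis unfolding diff .
  qed
  define k where "k s = nat \<lfloor>\<bar>s\<bar> / h\<rfloor>" for s
  have k: "real (k s) * h \<le> s" "s \<le> real (k s) * h + h" if "0 \<le> s" for s
  proof -
    have "real (k s) \<le> s / h" "s / h \<le> real (k s) + 1" using that h unfolding k_def by (simp_all)
    then show "real (k s) * h \<le> s" "s \<le> real (k s) * h + h" using h by (simp_all add: field_simps)
  qed
  \<comment> \<open>The multiple \<open>k s * h\<close> is a translation with error
    \<open>2 * e\<close>, and the remainder \<open>r\<close> contributes another \<open>e\<close>
    through \<open>z_near\<close>.\<close>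
  have period_nonneg: "cmod (cis (\<omega> * s) - 1) * norm (A L 0) \<le> 3 * e + (real (k s) + 1) * (2 * B / real L)"
    if s: "translation_close I f e s" "0 \<le> s" and L: "L > 0" for s L
  proof -
    define r where "r = s - real (k s) * h"
    have r: "0 \<le> r" "r \<le> h" using k[OF s(2)] by (auto simp: r_def)
    have "translation_close I f (e + e) (s + - r)"
      by (rule translation_close_add[OF I s(1) small]) (use r in simp)
    then have "translation_close I f (2 * e) (real (k s) * h)" by (simp add: r_def)
    then have "norm (A L (0 + real (k s) * h) - A L 0) \<le> 2 * e"
      using I_add[OF I0, of "real (k s) * h"] h L by (intro close[OF _ I0]) auto
    moreover have "norm (A L (0 + real (k s) * h) - inverse z ^ k s *\<^sub>C A L 0) \<le> real (k s) * (2 * B / real L)"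
      by (rule shift[OF I0 L])
    ultimately have "norm (inverse z ^ k s *\<^sub>C A L 0 - 1 *\<^sub>C A L 0) \<le> 2 * e + real (k s) * (2 * B / real L)"
      using norm_triangle_ineq4[of "A L (0 + real (k s) * h) - A L 0" "A L (0 + real (k s) * h) - inverse z ^ k s *\<^sub>C A L 0"]
      by (simp add: scaleC_one)
    then have 1: "cmod (cis (\<omega> * (real (k s) * h)) - 1) * norm (A L 0) \<le> 2 * e + real (k s) * (2 * B / real L)"
      unfolding diff cis_kh .
    have 2: "cmod (cis (\<omega> * r) - 1) * norm (A L 0) \<le> e + 2 * B / real L"
      using z_near[OF L] cis_r[OF r] by (meson mult_right_mono norm_ge_zero order_trans)
    have "cis (\<omega> * s) - 1 = cis (\<omega> * r) * (cis (\<omega> * (real (k s) * h)) - 1) + (cis (\<omega> * r) - 1)"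
      by (simp add: r_def cis_mult algebra_simps)
    then have "cmod (cis (\<omega> * s) - 1) \<le> cmod (cis (\<omega> * (real (k s) * h)) - 1) + cmod (cis (\<omega> * r) - 1)"
      by (metis norm_triangle_ineq norm_mult norm_cis mult_1)
    then have "cmod (cis (\<omega> * s) - 1) * norm (A L 0)
      \<le> (cmod (cis (\<omega> * (real (k s) * h)) - 1) + cmod (cis (\<omega> * r) - 1)) * norm (A L 0)"
      by (rule mult_right_mono) simp
    with 1 2 show ?thesis by (simp add: algebra_simps add_divide_distrib)
  qed
  have period: "cmod (cis (\<omega> * s) - 1) * norm (A L 0) \<le> 3 * e + (real (k s) + 1) * (2 * B / real L)"
    if s: "translation_close I f e s" and L: "L > 0" for s L
  proof (cases "0 \<le> s")
    case True
    then show ?thesis using period_nonneg s L by blast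
  next
    case False
    have "cmod (cis (\<omega> * s) - 1) = cmod (cis (\<omega> * - s) - 1)"
      by (metis cis_cnj complex_cnj_diff complex_cnj_one complex_mod_cnj mult_minus_right)
    moreover have "k (- s) = k s" by (simp add: k_def)
    ultimately show ?thesis
      using period_nonneg[OF translation_close_minus[OF s] _ L] False by simp
  qed
  \<comment> \<open>The bound for a single nearly extremal almost period controls all of them at once.\<close>
  define S where "S = {s. translation_close I f e s}"
  obtain s0 where s0: "s0 \<in> S" and max: "\<And>s. s \<in> S \<Longrightarrow> cmod (cis (\<omega> * s) - 1) \<le> 2 * cmod (cis (\<omega> * s0) - 1)"
  proof (cases "\<exists>s\<in>S. cmod (cis (\<omega> * s) - 1) > 0")
    case True
    then obtain s1 where s1: "s1 \<in> S" "cmod (cis (\<omega> * s1) - 1) > 0" by blast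
    define v where "v = (SUP s\<in>S. cmod (cis (\<omega> * s) - 1))"
    have bdd: "bdd_above ((\<lambda>s. cmod (cis (\<omega> * s) - 1)) ` S)"
      by (rule bdd_aboveI[of _ 2]) (auto intro: order_trans[OF norm_triangle_ineq4])
    have le: "cmod (cis (\<omega> * s) - 1) \<le> v" if "s \<in> S" for s
      unfolding v_def by (rule cSUP_upper[OF that bdd])
    have "v / 2 < v" using le[OF s1(1)] s1(2) by linarith
    then obtain s0 where "s0 \<in> S" "v / 2 < cmod (cis (\<omega> * s0) - 1)"
      using less_cSUP_iff[OF _ bdd] s1(1) unfolding v_def by blast
    then show thesis using that[of s0] le by fastforce
  next
    case False
    moreover have "0 \<in> S" using e by (simp add: S_def translation_close_def)
    ultimately show thesis using that[of 0] by fastforce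
  qed
  obtain l where l: "l > 0" and dense: "\<And>t. t \<in> I \<Longrightarrow> \<exists>\<tau>. translation_close I f e \<tau> \<and> \<tau> \<le> t \<and> t \<le> \<tau> + l"
    using translation_close_relatively_dense[OF I f e] by blast
  \<comment> \<open>\<open>C / L\<close> dominates all boundary terms: those in the bound for
    \<open>s0\<close>, counted by \<open>k s0 + 1\<close>, and those of the walk along the grid
    below, which has at most \<open>l / h\<close> steps.\<close>
  define C where "C = max (real (k s0) + 1) (l / h + 1) * (2 * B)"
  have "\<forall>\<^sub>F L in sequentially. L > 0 \<and> C / e \<le> real L"
    using eventually_gt_at_top[of 0] filterlim_real_sequentially[unfolded filterlim_at_top, rule_format, of "C / e"]
    by eventually_elim simp
  then have "\<forall>\<^sub>F L in sequentially. \<forall>t\<in>I. norm (A L t - cis (\<omega> * t) *\<^sub>C A L 0) \<le> 13 * e"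
  proof eventually_elim
    case (elim L)
    then have L: "L > 0" by simp
    define \<kappa> where "\<kappa> = 2 * B / real L"
    have \<kappa>: "\<kappa> > 0" using B L by (simp add: \<kappa>_def)
    have "C / real L \<le> e" using elim e by (simp add: field_simps)
    then have C: "x * \<kappa> \<le> e" if "x \<le> max (real (k s0) + 1) (l / h + 1)" for x
      using mult_right_mono[OF that, of \<kappa>] \<kappa> by (simp add: C_def \<kappa>_def)
    have all_periods: "cmod (cis (\<omega> * s) - 1) * norm (A L 0) \<le> 8 * e" if "s \<in> S" for s
    proof -
      have "cmod (cis (\<omega> * s) - 1) * norm (A L 0) \<le> 2 * cmod (cis (\<omega> * s0) - 1) * norm (A L 0)"
        by (intro mult_right_mono max that) simp
      also have "\<dots> \<le> 2 * (3 * e + (real (k s0) + 1) * \<kappa>)"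
        using period[of s0 L] s0 L by (simp add: S_def \<kappa>_def)
      also have "\<dots> \<le> 8 * e" using C[of "real (k s0) + 1"] by simp
      finally show ?thesis .
    qed
    show ?case
    proof
      fix t assume t: "t \<in> I"
      obtain \<tau> where \<tau>: "translation_close I f e \<tau>" "\<tau> \<le> t" "t \<le> \<tau> + l" using dense[OF t] by blast
      define n where "n = k (t - \<tau>)"
      define r where "r = t - \<tau> - real n * h"
      have r: "0 \<le> r" "r \<le> h" using k[of "t - \<tau>"] \<tau> by (auto simp: r_def n_def)
      have nh: "real n * h \<in> I" using I_add[OF I0, of "real n * h"] h by simp
      have u: "t - \<tau> \<in> I" using I_add[OF I0, of "t - \<tau>"] \<tau> by simp
      have "real n * h \<le> l" using r \<tau> by (simp add: r_def)
      then have nl: "real n \<le> l / h" using h by (simp add: field_simps)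
      have 1: "norm (A L t - A L (t - \<tau>)) \<le> e" using close[OF \<tau>(1) u _ L] t by simp
      have 2: "norm (A L (t - \<tau>) - A L (real n * h)) \<le> e"
        using close[OF small[of r] nh _ L] r u by (simp add: r_def)
      have 3: "norm (A L (real n * h) - inverse z ^ n *\<^sub>C A L 0) \<le> e"
      proof -
        have "real n * \<kappa> \<le> e"
          by (rule C, rule order_trans[OF _ max.cobounded2]) (use nl in simp)
        then show ?thesis using shift[OF I0 L, of n] by (simp add: \<kappa>_def)
      qed
      \<comment> \<open>This uses \<open>t = \<tau> + n * h + r\<close>: the almost period
        contributes \<open>8 * e\<close> and the remainder \<open>e + \<kappa> \<le> 2 * e\<close>.
        Together with the three estimates above the total is \<open>13 * e\<close>.\<close>
      have "cis (\<omega> * t) - inverse z ^ n = inverse z ^ n * ((cis (\<omega> * \<tau>) - 1) * cis (\<omega> * r) + (cis (\<omega> * r) - 1))"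
        unfolding cis_kh[symmetric] by (simp add: r_def cis_mult algebra_simps)
      then have "cmod (cis (\<omega> * t) - inverse z ^ n) \<le> cmod (cis (\<omega> * \<tau>) - 1) + cmod (cis (\<omega> * r) - 1)"
        using norm_triangle_ineq[of "(cis (\<omega> * \<tau>) - 1) * cis (\<omega> * r)" "cis (\<omega> * r) - 1"]
        by (simp add: norm_mult norm_power iz)
      then have "cmod (cis (\<omega> * t) - inverse z ^ n) * norm (A L 0)
        \<le> (cmod (cis (\<omega> * \<tau>) - 1) + cmod (cis (\<omega> * r) - 1)) * norm (A L 0)"
        by (rule mult_right_mono) simp
      also have "\<dots> \<le> 8 * e + (e + \<kappa>)"
        using all_periods[of \<tau>] \<tau>(1) z_near[OF L] mult_right_mono[OF cis_r[OF r], of "norm (A L 0)"]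
        by (simp add: S_def \<kappa>_def distrib_right)
      also have "\<dots> \<le> 10 * e" using C[of 1] h l by simp
      finally have 4: "norm (cis (\<omega> * t) *\<^sub>C A L 0 - inverse z ^ n *\<^sub>C A L 0) \<le> 10 * e"
        unfolding diff .
      have "A L t - cis (\<omega> * t) *\<^sub>C A L 0 = (A L t - A L (t - \<tau>)) + (A L (t - \<tau>) - A L (real n * h))
        + (A L (real n * h) - inverse z ^ n *\<^sub>C A L 0) - (cis (\<omega> * t) *\<^sub>C A L 0 - inverse z ^ n *\<^sub>C A L 0)"
        by simp
      also have "norm \<dots> \<le> e + e + e + 10 * e"
        by (intro order_trans[OF norm_triangle_ineq4] add_mono order_trans[OF norm_triangle_ineq] 1 2 3 4)
      finally show "norm (A L t - cis (\<omega> * t) *\<^sub>C A L 0) \<le> 13 * e" by simp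
    qed
  qed
  then show ?thesis by blast
qed

text \<open>The order in which the constants are chosen matters: the tolerances
  \<open>\<delta>\<close> and \<open>\<eta>\<close> must be small compared with the average weight
  \<open>\<mu>\<close>, whose lower bound \<open>d\<close> comes from the density \<open>c\<close>
  and is independent of the mesh; only then is the mesh fixed.\<close>

theorem almost_periodic_approximation:
  fixes f :: "real \<Rightarrow> 'a::complex_banach"
  assumes I: "I = UNIV \<or> I = {0..}" and f: "almost_periodic I f" and e: "e > 0"
  obtains J :: nat and \<omega> x where "\<And>t. t \<in> I \<Longrightarrow> norm (f t - (\<Sum>j<J. cis (\<omega> j * t) *\<^sub>C x j)) \<le> e"
proof -
  obtain B where B: "B > 0" "\<And>t. t \<in> I \<Longrightarrow> norm (f t) \<le> B" using almost_periodic_bounded[OF I f] by blast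
  \<comment> \<open>Four units are spent because the weights live on translations with error
    \<open>4 * \<epsilon>\<close>, one on replacing \<open>W\<close> by the exponential polynomial,
    and one on replacing twisted averages by characters.\<close>
  define \<epsilon> where "\<epsilon> = e / 6"
  have \<epsilon>: "\<epsilon> > 0" using e by (simp add: \<epsilon>_def)
  obtain c \<rho> where c: "c > 0" and \<rho>: "\<rho> > 0" and density: "\<And>q. q > 0 \<Longrightarrow> \<exists>m0. \<forall>m\<ge>m0. c * real m
        \<le> real (card ({j. translation_close I f \<epsilon> (real j * (\<rho> / real q))} \<inter> {..<m}))"
    using translation_close_density[OF I f \<epsilon>] by blast
  \<comment> \<open>Half of \<open>c ^ 4 / 6\<close>: since \<open>\<delta>\<^sup>2 \<le> d\<close>,
    the average weight remains at least \<open>d\<close>.\<close>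
  define d where "d = c ^ 4 / 12"
  have d: "d > 0" using c by (simp add: d_def)
  define \<delta> where "\<delta> = sqrt (min d (\<epsilon> * d / (2 * B)))"
  have \<delta>: "\<delta> > 0" "\<delta>\<^sup>2 \<le> d" "2 * \<delta>\<^sup>2 * B \<le> \<epsilon> * d"
    using d \<epsilon> B by (auto simp: \<delta>_def min_def field_simps)
  define \<eta> where "\<eta> = \<epsilon> * d / 13"
  have \<eta>: "\<eta> > 0" using \<epsilon> d by (simp add: \<eta>_def)
  obtain \<rho>' where \<rho>': "\<rho>' > 0" "\<And>s. \<bar>s\<bar> \<le> \<rho>' \<Longrightarrow> translation_close I f \<eta> s"
    using translation_close_small[OF I f \<eta>] by blast
  \<comment> \<open>The grid is refined until its mesh \<open>h\<close> is at most
    \<open>\<rho>'\<close>, so that every translation by at most one grid step has error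
    \<open>\<eta>\<close>.\<close>
  define q where "q = Suc (nat \<lceil>\<rho> / \<rho>'\<rceil>)"
  define h where "h = \<rho> / real q"
  have q: "q > 0" by (simp add: q_def)
  have h: "h > 0" using \<rho> by (simp add: h_def q_def)
  have "\<rho> / \<rho>' \<le> real q" unfolding q_def by linarith
  then have "h \<le> \<rho>'" using \<rho>' q by (simp add: h_def field_simps)
  with \<rho>' have small: "translation_close I f \<eta> s" if "\<bar>s\<bar> \<le> h" for s using that by simp
  define E where "E = {j. translation_close I f \<epsilon> (real j * h)}"
  obtain m0 where m0: "\<forall>m\<ge>m0. c * real m \<le> real (card (E \<inter> {..<m}))"
    using density[OF q] unfolding E_def h_def by blast
  show thesis
  proof (rule bogolyubov[OF m0 less_imp_le[OF c] \<delta>(1)])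
    fix J :: nat and W b :: "nat \<Rightarrow> real" and z :: "nat \<Rightarrow> complex"
    assume W0: "\<And>l. 0 \<le> W l"
      and WE: "\<And>l. W l \<noteq> 0 \<Longrightarrow> \<exists>p\<in>E. \<exists>q\<in>E. \<exists>r\<in>E. \<exists>s\<in>E. l + p + q = r + s"
      and WP: "\<And>l. cmod (of_real (W l) - (\<Sum>j<J. of_real (b j) * z j ^ l)) \<le> 2 * \<delta>\<^sup>2"
      and b: "\<And>j. j < J \<Longrightarrow> 0 \<le> b j" "(\<Sum>j<J. b j) \<le> 1" and z: "\<And>j. j < J \<Longrightarrow> cmod (z j) = 1"
      and WL: "\<And>L. real L * (c ^ 4 / 6 - \<delta>\<^sup>2) \<le> (\<Sum>l<L. W l)"
    define A where "A j L t = (1 / real L) *\<^sub>R (\<Sum>l<L. z j ^ l *\<^sub>C f (t + real l * h))" for j L t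
    have "\<exists>\<omega>. \<forall>\<^sub>F L in sequentially. \<forall>t\<in>I. norm (A j L t - cis (\<omega> * t) *\<^sub>C A j L 0) \<le> 13 * \<eta>" if "j < J" for j
      unfolding A_def by (rule twisted_average_almost_character[OF I f \<eta> h small z[OF that]])
    then have "\<forall>j\<in>{..<J}. \<exists>\<omega>. \<forall>\<^sub>F L in sequentially. \<forall>t\<in>I. norm (A j L t - cis (\<omega> * t) *\<^sub>C A j L 0) \<le> 13 * \<eta>"
      by simp
    from bchoice[OF this] obtain \<omega> where
      "\<forall>j\<in>{..<J}. \<forall>\<^sub>F L in sequentially. \<forall>t\<in>I. norm (A j L t - cis (\<omega> j * t) *\<^sub>C A j L 0) \<le> 13 * \<eta>" ..
    then have "\<forall>\<^sub>F L in sequentially. \<forall>j\<in>{..<J}. \<forall>t\<in>I. norm (A j L t - cis (\<omega> j * t) *\<^sub>C A j L 0) \<le> 13 * \<eta>"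
      by (intro eventually_ball_finite) simp_all
    then have "\<forall>\<^sub>F L in sequentially. L > 0 \<and> (\<forall>j\<in>{..<J}. \<forall>t\<in>I. norm (A j L t - cis (\<omega> j * t) *\<^sub>C A j L 0) \<le> 13 * \<eta>)"
      using eventually_gt_at_top[of 0] by eventually_elim simp
    from eventually_happens'[OF sequentially_bot this] obtain L where L: "L > 0"
      and "\<forall>j\<in>{..<J}. \<forall>t\<in>I. norm (A j L t - cis (\<omega> j * t) *\<^sub>C A j L 0) \<le> 13 * \<eta>"
      by (elim exE conjE)
    then have char: "norm (A j L t - cis (\<omega> j * t) *\<^sub>C A j L 0) \<le> 13 * \<eta>" if "j < J" "t \<in> I" for j t
      using that by simp
    define \<mu> where "\<mu> = (\<Sum>l<L. W l) / real L"
    have "d \<le> \<mu>"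
    proof -
      have "real L * d \<le> real L * (c ^ 4 / 6 - \<delta>\<^sup>2)" using \<delta>(2) L by (simp add: d_def)
      then show ?thesis using WL[of L] L by (simp add: \<mu>_def field_simps)
    qed
    then have \<mu>: "\<mu> > 0" using d by simp
    define x where "x j = (of_real (b j / \<mu>)) *\<^sub>C A j L 0" for j
    have W_close: "translation_close I f (4 * \<epsilon>) (real l * h)" if Wl: "W l \<noteq> 0" for l
    proof -
      obtain p q r s where E: "p \<in> E" "q \<in> E" "r \<in> E" "s \<in> E" and "l + p + q = r + s"
        using WE[OF Wl] by blast
      then have rl: "real l = real r + real s - real p - real q" by linarith
      have "real l * h = ((real r * h + real s * h) + - (real p * h)) + - (real q * h)"
        unfolding rl by (simp add: algebra_simps)
      moreover have "translation_close I f (((\<epsilon> + \<epsilon>) + \<epsilon>) + \<epsilon>) (((real r * h + real s * h) + - (real p * h)) + - (real q * h))"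
        using E by (intro translation_close_add[OF I] translation_close_minus) (auto simp: E_def)
      ultimately show ?thesis by simp
    qed
    show thesis
    proof (rule that)
      fix t assume t: "t \<in> I"
      have tl: "t + real l * h \<in> I" for l using t I h by auto
      have 1: "norm (\<mu> *\<^sub>R f t - (1 / real L) *\<^sub>R (\<Sum>l<L. W l *\<^sub>R f (t + real l * h))) \<le> 4 * \<epsilon> * \<mu>"
      proof -
        have "\<mu> *\<^sub>R f t - (1 / real L) *\<^sub>R (\<Sum>l<L. W l *\<^sub>R f (t + real l * h))
          = (1 / real L) *\<^sub>R (\<Sum>l<L. W l *\<^sub>R (f t - f (t + real l * h)))"
          by (simp add: \<mu>_def scaleR_diff_right sum_subtractf scaleR_sum_left divide_inverse mult.commute)
            (simp flip: scaleR_scaleR scaleR_sum_left)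
        also have "norm \<dots> \<le> (1 / real L) * (\<Sum>l<L. W l * (4 * \<epsilon>))"
        proof -
          have "norm (W l *\<^sub>R (f t - f (t + real l * h))) \<le> W l * (4 * \<epsilon>)" for l
            using translation_closeD[OF W_close t tl] W0[of l]
            by (cases "W l = 0") (auto simp: norm_minus_commute intro!: mult_left_mono)
          then show ?thesis by (rule norm_average_le)
        qed
        also have "\<dots> = 4 * \<epsilon> * \<mu>" by (simp add: \<mu>_def flip: sum_distrib_right)
        finally show ?thesis .
      qed
      have 2: "norm ((1 / real L) *\<^sub>R (\<Sum>l<L. W l *\<^sub>R f (t + real l * h)) - (\<Sum>j<J. of_real (b j) *\<^sub>C A j L t)) \<le> 2 * \<delta>\<^sup>2 * B"
      proof -
        have "(\<Sum>j<J. of_real (b j) *\<^sub>C A j L t)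
          = (1 / real L) *\<^sub>R (\<Sum>j<J. \<Sum>l<L. (of_real (b j) * z j ^ l) *\<^sub>C f (t + real l * h))"
          by (simp add: A_def scaleR_scaleC complex_scaling.scale_sum_right scaleC_scaleC mult_ac)
        also have "\<dots> = (1 / real L) *\<^sub>R (\<Sum>l<L. (\<Sum>j<J. of_real (b j) * z j ^ l) *\<^sub>C f (t + real l * h))"
          by (subst sum.swap) (simp add: complex_scaling.scale_sum_left)
        finally have "(1 / real L) *\<^sub>R (\<Sum>l<L. W l *\<^sub>R f (t + real l * h)) - (\<Sum>j<J. of_real (b j) *\<^sub>C A j L t)
          = (1 / real L) *\<^sub>R (\<Sum>l<L. (of_real (W l) - (\<Sum>j<J. of_real (b j) * z j ^ l)) *\<^sub>C f (t + real l * h))"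
          by (simp add: scaleR_scaleC[of "W _"] complex_scaling.scale_left_diff_distrib sum_subtractf scaleR_diff_right)
        also have "norm \<dots> \<le> (1 / real L) * (\<Sum>l<L. 2 * \<delta>\<^sup>2 * B)"
        proof -
          have "norm ((of_real (W l) - (\<Sum>j<J. of_real (b j) * z j ^ l)) *\<^sub>C f (t + real l * h)) \<le> 2 * \<delta>\<^sup>2 * B" for l
            unfolding norm_scaleC by (intro mult_mono WP B tl) auto
          then show ?thesis by (rule norm_average_le)
        qed
        also have "\<dots> = 2 * \<delta>\<^sup>2 * B" using L by simp
        finally show ?thesis .
      qed
      have 3: "norm ((\<Sum>j<J. of_real (b j) *\<^sub>C A j L t) - \<mu> *\<^sub>R (\<Sum>j<J. cis (\<omega> j * t) *\<^sub>C x j)) \<le> 13 * \<eta>"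
      proof -
        have "\<mu> *\<^sub>R (\<Sum>j<J. cis (\<omega> j * t) *\<^sub>C x j) = (\<Sum>j<J. of_real (b j) *\<^sub>C (cis (\<omega> j * t) *\<^sub>C A j L 0))"
          using \<mu> by (simp add: x_def scaleR_scaleC complex_scaling.scale_sum_right scaleC_scaleC mult_ac)
        then have "(\<Sum>j<J. of_real (b j) *\<^sub>C A j L t) - \<mu> *\<^sub>R (\<Sum>j<J. cis (\<omega> j * t) *\<^sub>C x j)
          = (\<Sum>j<J. of_real (b j) *\<^sub>C (A j L t - cis (\<omega> j * t) *\<^sub>C A j L 0))"
          by (simp add: sum_subtractf complex_scaling.scale_right_diff_distrib)
        also have "norm \<dots> \<le> (\<Sum>j<J. b j * (13 * \<eta>))"
          by (rule order_trans[OF norm_sum])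
            (intro sum_mono, use b char t in \<open>auto simp: norm_scaleC intro!: mult_left_mono\<close>)
        also have "\<dots> = (\<Sum>j<J. b j) * (13 * \<eta>)" by (simp flip: sum_distrib_right)
        also have "\<dots> \<le> 1 * (13 * \<eta>)" using b \<eta> by (intro mult_right_mono) auto
        finally show ?thesis by simp
      qed
      have "\<mu> *\<^sub>R (f t - (\<Sum>j<J. cis (\<omega> j * t) *\<^sub>C x j))
        = (\<mu> *\<^sub>R f t - (1 / real L) *\<^sub>R (\<Sum>l<L. W l *\<^sub>R f (t + real l * h)))
        + ((1 / real L) *\<^sub>R (\<Sum>l<L. W l *\<^sub>R f (t + real l * h)) - (\<Sum>j<J. of_real (b j) *\<^sub>C A j L t))
        + ((\<Sum>j<J. of_real (b j) *\<^sub>C A j L t) - \<mu> *\<^sub>R (\<Sum>j<J. cis (\<omega> j * t) *\<^sub>C x j))"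
        by (simp add: scaleR_diff_right)
      also have "norm \<dots> \<le> 4 * \<epsilon> * \<mu> + 2 * \<delta>\<^sup>2 * B + 13 * \<eta>"
        by (intro order_trans[OF norm_triangle_ineq] add_mono 1 2 3)
      also have "\<dots> \<le> 4 * \<epsilon> * \<mu> + \<epsilon> * \<mu> + \<epsilon> * \<mu>"
      proof -
        have "\<epsilon> * d \<le> \<epsilon> * \<mu>" by (rule mult_left_mono[OF \<open>d \<le> \<mu>\<close>]) (use \<epsilon> in simp)
        moreover have "13 * \<eta> = \<epsilon> * d" by (simp add: \<eta>_def)
        ultimately show ?thesis using \<delta>(3) by linarith
      qed
      also have "\<dots> = \<mu> * e" by (simp add: \<epsilon>_def)
      finally show "norm (f t - (\<Sum>j<J. cis (\<omega> j * t) *\<^sub>C x j)) \<le> e"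
        using \<mu> by simp
    qed
  qed
qed

section \<open>Characters and trigonometric polynomials\<close>

lemma continuous_on_character:
  fixes x :: "'a::complex_normed_vector"
  shows "continuous_on S (\<lambda>t. cis (\<omega> * t) *\<^sub>C x)"
  by (rule bounded_linear.continuous_on[OF bounded_linear_scaleC_left]) (intro continuous_intros)

text \<open>The odd multiples of \<open>pi / \<bar>\<omega>\<bar>\<close> are exact antiperiods of
  the character, and consecutive ones are \<open>2 * pi / \<bar>\<omega>\<bar>\<close>
  apart.\<close>

lemma almost_anti_periodic_character:
  fixes x :: "'a::complex_normed_vector"
  assumes "\<omega> \<noteq> 0"
  shows "almost_anti_periodic I (\<lambda>t. cis (\<omega> * t) *\<^sub>C x)"
  unfolding almost_anti_periodic_def
proof (intro conjI allI impI)
  fix e :: real assume e: "e > 0"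
  define p where "p = pi / \<bar>\<omega>\<bar>"
  have p: "p > 0" using assms by (simp add: p_def)
  show "relatively_dense I (antiperiods I (\<lambda>t. cis (\<omega> * t) *\<^sub>C x) e)"
    unfolding relatively_dense_def
  proof (intro conjI exI[of _ "2 * p"] allI impI)
    fix a assume a: "{a..a + 2 * p} \<subseteq> I"
    \<comment> \<open>\<open>v\<close> solves \<open>(2 * v + 1) * p = a\<close>, so rounding it up
      gives the first odd multiple of \<open>p\<close> that is at least \<open>a\<close>; being an
      odd multiple, it is not 0.\<close>
    define v where "v = (a / p - 1) / 2"
    define k where "k = \<lceil>v\<rceil>"
    define \<tau> where "\<tau> = (2 * of_int k + 1) * p"
    have "v \<le> of_int k" "of_int k \<le> v + 1" unfolding k_def by linarith+
    moreover have "a / p = 2 * v + 1" by (simp add: v_def diff_divide_distrib)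
    ultimately have "a / p \<le> 2 * of_int k + 1" "2 * of_int k + 1 \<le> a / p + 2" by auto
    then have "a / p * p \<le> \<tau>" "\<tau> \<le> (a / p + 2) * p"
      unfolding \<tau>_def using p by (intro mult_right_mono; simp)+
    then have \<tau>: "\<tau> \<in> {a..a + 2 * p}" using p by (simp add: algebra_simps)
    have "2 * k + 1 \<noteq> 0" by presburger
    then have "real_of_int (2 * k + 1) \<noteq> 0" by (simp only: of_int_eq_0_iff not_False_eq_True)
    moreover have "\<tau> = real_of_int (2 * k + 1) * p" by (simp add: \<tau>_def)
    ultimately have "\<tau> \<noteq> 0" using p by (simp only: mult_eq_0_iff) simp
    have "\<omega> * \<tau> = sgn \<omega> * (2 * pi * of_int k + pi)"
      using assms by (simp add: \<tau>_def p_def sgn_if field_simps)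
    moreover have "cis (2 * pi * of_int k + pi) = -1"
      by (simp flip: cis_mult)
    moreover from this have "cis (- (2 * pi * of_int k + pi)) = -1"
      by (metis cis_cnj complex_cnj_minus complex_cnj_one)
    ultimately have "cis (\<omega> * \<tau>) = -1" using assms by (cases "\<omega> > 0") (simp_all add: sgn_if)
    then have "cis (\<omega> * (t + \<tau>)) = - cis (\<omega> * t)" for t
      by (simp add: distrib_left flip: cis_mult)
    then have "\<tau> \<in> antiperiods I (\<lambda>t. cis (\<omega> * t) *\<^sub>C x) e"
      using \<tau> a \<open>\<tau> \<noteq> 0\<close> e by (auto simp: antiperiods_def)
    with \<tau> show "{a..a + 2 * p} \<inter> antiperiods I (\<lambda>t. cis (\<omega> * t) *\<^sub>C x) e \<noteq> {}" by blast
  qed (use p in \<open>auto simp: antiperiods_def\<close>)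
qed (rule continuous_on_character)

text \<open>Pigeonhole on the torus: the values of the \<open>J\<close> characters fall into
  finitely many cells, and \<open>R\<close> bounds one representative argument \<open>r\<close> for
  each occupied cell.\<close>

lemma simultaneous_near_periods:
  fixes \<omega> :: "nat \<Rightarrow> real" and d :: real
  assumes d: "d > 0"
  obtains R where "R > 0" "\<And>s. \<exists>r. \<bar>r\<bar> \<le> R \<and> (\<forall>j<J. cmod (cis (\<omega> j * (s - r)) - 1) \<le> d)"
proof -
  \<comment> \<open>Cells of width \<open>d / 2\<close> for cosine and sine separately add up to the
    distance \<open>d\<close> in the complex plane.\<close>
  define cell where "cell u = \<lfloor>2 * u / d\<rfloor>" for u
  have cell: "\<bar>u - v\<bar> \<le> d / 2" if "cell u = cell v" for u v
  proof -
    have "\<bar>2 * u / d - 2 * v / d\<bar> < 1" using that unfolding cell_def by linarith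
    then have "\<bar>2 * (u - v) / d\<bar> < 1" by (simp add: diff_divide_distrib right_diff_distrib)
    then have "\<bar>2 * (u - v)\<bar> < d" using d by simp
    then show ?thesis unfolding abs_mult by simp
  qed
  define N where "N = \<lceil>2 / d\<rceil>"
  have cell_bound: "cell u \<in> {- N..N}" if "\<bar>u\<bar> \<le> 1" for u
  proof -
    have "- (2 / d) \<le> 2 * u / d" "2 * u / d \<le> 2 / d" using that d by (simp_all add: field_simps)
    then show ?thesis unfolding cell_def N_def by simp linarith
  qed
  define c where "c s = restrict (\<lambda>j. (cell (cos (\<omega> j * s)), cell (sin (\<omega> j * s)))) {..<J}" for s
  have "c s \<in> PiE {..<J} (\<lambda>_. {- N..N} \<times> {- N..N})" for s
    unfolding c_def using cell_bound by auto
  then have "range c \<subseteq> PiE {..<J} (\<lambda>_. {- N..N} \<times> {- N..N})" by blast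
  then have "finite (range c)" by (rule finite_subset) (intro finite_PiE; simp)
  then obtain T where T: "finite T" "range c = c ` T"
    using finite_subset_image[of "range c" c UNIV] by auto
  define R where "R = Max (insert 1 (abs ` T))"
  show ?thesis
  proof
    show "R > 0" using T(1) unfolding R_def by (subst Max_gr_iff) auto
    fix s
    obtain r where r: "r \<in> T" "c s = c r" using T(2) by blast
    have "\<bar>r\<bar> \<le> R" using T(1) r(1) unfolding R_def by (intro Max_ge) auto
    moreover have "cmod (cis (\<omega> j * (s - r)) - 1) \<le> d" if "j < J" for j
    proof -
      have "cell (cos (\<omega> j * s)) = cell (cos (\<omega> j * r))" "cell (sin (\<omega> j * s)) = cell (sin (\<omega> j * r))"
        using fun_cong[OF r(2), of j] that by (simp_all add: c_def)
      then have "cmod (cis (\<omega> j * s) - cis (\<omega> j * r)) \<le> d"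
        using cmod_le[of "cis (\<omega> j * s) - cis (\<omega> j * r)"]
          cell[of "cos (\<omega> j * s)" "cos (\<omega> j * r)"] cell[of "sin (\<omega> j * s)" "sin (\<omega> j * r)"] by simp
      moreover have "cis (\<omega> j * s) - cis (\<omega> j * r) = cis (\<omega> j * r) * (cis (\<omega> j * (s - r)) - 1)"
        by (simp add: cis_mult right_diff_distrib)
      ultimately show ?thesis by (simp add: norm_mult)
    qed
    ultimately show "\<exists>r. \<bar>r\<bar> \<le> R \<and> (\<forall>j<J. cmod (cis (\<omega> j * (s - r)) - 1) \<le> d)" by blast
  qed
qed

text \<open>A common near-period of all the characters is an almost period of the sum. The lemma
  serves to place the trigonometric approximants in \<open>AP I\<close>, where the closure is
  taken.\<close>

lemma almost_periodic_trigonometric_polynomial: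
  fixes x :: "nat \<Rightarrow> 'a::complex_normed_vector"
  shows "almost_periodic I (\<lambda>t. \<Sum>j<J. cis (\<omega> j * t) *\<^sub>C x j)"
  unfolding almost_periodic_def
proof (intro conjI allI impI)
  show "continuous_on I (\<lambda>t. \<Sum>j<J. cis (\<omega> j * t) *\<^sub>C x j)"
    by (intro continuous_on_sum continuous_on_character)
  fix e :: real assume e: "e > 0"
  define X where "X = (\<Sum>j<J. norm (x j)) + 1"
  have X: "X > 0" unfolding X_def by (intro add_nonneg_pos sum_nonneg) auto
  obtain R where R: "R > 0" and near: "\<And>s. \<exists>r. \<bar>r\<bar> \<le> R \<and> (\<forall>j<J. cmod (cis (\<omega> j * (s - r)) - 1) \<le> e / X)"
    using simultaneous_near_periods[of "e / X" J \<omega>] e X by auto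
  have period: "norm ((\<Sum>j<J. cis (\<omega> j * (t + \<tau>)) *\<^sub>C x j) - (\<Sum>j<J. cis (\<omega> j * t) *\<^sub>C x j)) \<le> e"
    if "\<forall>j<J. cmod (cis (\<omega> j * \<tau>) - 1) \<le> e / X" for \<tau> t
  proof -
    have "(\<Sum>j<J. cis (\<omega> j * (t + \<tau>)) *\<^sub>C x j) - (\<Sum>j<J. cis (\<omega> j * t) *\<^sub>C x j)
      = (\<Sum>j<J. (cis (\<omega> j * t) * (cis (\<omega> j * \<tau>) - 1)) *\<^sub>C x j)"
      by (simp add: cis_mult distrib_left right_diff_distrib complex_scaling.scale_left_diff_distrib sum_subtractf)
    also have "norm \<dots> \<le> (\<Sum>j<J. e / X * norm (x j))"
    proof (intro sum_norm_le)
      fix j assume "j \<in> {..<J}"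
      then have "cmod (cis (\<omega> j * \<tau>) - 1) * norm (x j) \<le> e / X * norm (x j)"
        using that by (intro mult_right_mono) auto
      then show "norm ((cis (\<omega> j * t) * (cis (\<omega> j * \<tau>) - 1)) *\<^sub>C x j) \<le> e / X * norm (x j)"
        by (simp add: norm_scaleC norm_mult)
    qed
    also have "\<dots> = e / X * (X - 1)" by (simp add: X_def sum_distrib_left)
    also have "\<dots> \<le> e" using e X by (simp add: field_simps)
    finally show ?thesis .
  qed
  show "relatively_dense I (periods I (\<lambda>t. \<Sum>j<J. cis (\<omega> j * t) *\<^sub>C x j) e)"
    unfolding relatively_dense_def
  proof (intro conjI exI[of _ "4 * R + 1"] allI impI)
    fix a assume a: "{a..a + (4 * R + 1)} \<subseteq> I"
    \<comment> \<open>Two disjoint windows, since 0 does not count as a period.\<close>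
    obtain r1 where r1: "\<bar>r1\<bar> \<le> R" "\<forall>j<J. cmod (cis (\<omega> j * (a + R - r1)) - 1) \<le> e / X"
      using near by blast
    obtain r2 where r2: "\<bar>r2\<bar> \<le> R" "\<forall>j<J. cmod (cis (\<omega> j * (a + 3 * R + 1 - r2)) - 1) \<le> e / X"
      using near by blast
    define \<tau> where "\<tau> = (if a + R - r1 = 0 then a + 3 * R + 1 - r2 else a + R - r1)"
    have \<tau>: "\<tau> \<in> {a..a + (4 * R + 1)}" "\<tau> \<noteq> 0" using r1(1) r2(1) R by (auto simp: \<tau>_def)
    have near_\<tau>: "\<forall>j<J. cmod (cis (\<omega> j * \<tau>) - 1) \<le> e / X" using r1 r2 by (simp add: \<tau>_def)
    have "\<tau> \<in> periods I (\<lambda>t. \<Sum>j<J. cis (\<omega> j * t) *\<^sub>C x j) e"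
      unfolding periods_def using subsetD[OF a \<tau>(1)] \<tau>(2) period[OF near_\<tau>] by simp
    with \<tau>(1) show "{a..a + (4 * R + 1)} \<inter> periods I (\<lambda>t. \<Sum>j<J. cis (\<omega> j * t) *\<^sub>C x j) e \<noteq> {}"
      by blast
  qed (use R in \<open>auto simp: periods_def\<close>)
qed

section \<open>Means\<close>

text \<open>Twice an antiperiod is a period with twice the error, because
  \<open>f (t + 2 * \<tau>) - f t\<close> is the difference of
  \<open>f (t + 2 * \<tau>) + f (t + \<tau>)\<close> and
  \<open>f (t + \<tau>) + f t\<close>.\<close>

lemma almost_anti_periodic_imp_almost_periodic:
  assumes I: "I = UNIV \<or> I = {0..}" and f: "almost_anti_periodic I f"
  shows "almost_periodic I f"
  unfolding almost_periodic_def
proof (intro conjI allI impI)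
  show "continuous_on I f" using f by (simp add: almost_anti_periodic_def)
  fix e :: real assume e: "e > 0"
  then have "relatively_dense I (antiperiods I f (e / 2))" using f by (simp add: almost_anti_periodic_def)
  then obtain l where l: "l > 0"
    and meets: "\<And>a. {a..a + l} \<subseteq> I \<Longrightarrow> {a..a + l} \<inter> antiperiods I f (e / 2) \<noteq> {}"
    unfolding relatively_dense_def by blast
  show "relatively_dense I (periods I f e)"
    unfolding relatively_dense_def
  proof (intro conjI exI[of _ "2 * l"] allI impI)
    fix a assume "{a..a + 2 * l} \<subseteq> I"
    then have "{a / 2..a / 2 + l} \<subseteq> I" using I l by auto
    from meets[OF this] obtain \<tau> where \<tau>: "\<tau> \<in> antiperiods I f (e / 2)" "a / 2 \<le> \<tau>" "\<tau> \<le> a / 2 + l" by auto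
    have anti: "norm (f (t + \<tau>) + f t) \<le> e / 2" if "t \<in> I" for t
      using \<tau>(1) that by (simp add: antiperiods_def)
    have "norm (f (t + 2 * \<tau>) - f t) \<le> e" if t: "t \<in> I" for t
    proof -
      have "t + \<tau> \<in> I" using t \<tau>(1) I by (auto simp: antiperiods_def)
      then show ?thesis
        using anti[OF t] anti[of "t + \<tau>"] norm_triangle_ineq4[of "f (t + \<tau> + \<tau>) + f (t + \<tau>)" "f (t + \<tau>) + f t"]
        by (simp add: algebra_simps)
    qed
    moreover have "2 * \<tau> \<in> I - {0}" using \<tau>(1) I by (auto simp: antiperiods_def)
    ultimately have "2 * \<tau> \<in> periods I f e" by (simp add: periods_def)
    with \<tau> show "{a..a + 2 * l} \<inter> periods I f e \<noteq> {}" by (intro notI) (auto dest: equals0D[of _ "2 * \<tau>"])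
  qed (use l in \<open>auto simp: periods_def\<close>)
qed

section \<open>Time averages along the half line\<close>

definition time_average :: "(real \<Rightarrow> 'a::banach) \<Rightarrow> real \<Rightarrow> 'a"
  where "time_average f t = (1 / t) *\<^sub>R integral {0..t} f"

text \<open>Only the nonnegative half line enters, also for \<open>I = UNIV\<close>, as in the Bohr
  transform. Continuity is included so that integrals are additive and the predicate describes a
  linear subspace.\<close>

definition mean_zero :: "(real \<Rightarrow> 'a::banach) \<Rightarrow> bool"
  where "mean_zero f \<longleftrightarrow> continuous_on {0..} f \<and> (time_average f \<longlongrightarrow> 0) at_top"

lemma integrable_half_line:
  fixes f :: "real \<Rightarrow> 'a::banach"
  shows "continuous_on {0..} f \<Longrightarrow> 0 \<le> a \<Longrightarrow> f integrable_on {a..b}"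
  by (rule integrable_continuous_real) (auto intro: continuous_on_subset)

lemma time_average_bound:
  assumes f: "continuous_on {0..} f" and e: "\<And>s. s \<ge> 0 \<Longrightarrow> norm (f s) \<le> e" and t: "t > 0"
  shows "norm (time_average f t) \<le> e"
proof -
  have "norm (integral {0..t} f) \<le> e * (t - 0)"
    by (rule integral_bound) (use t e in \<open>auto intro: continuous_on_subset[OF f]\<close>)
  then show ?thesis using t by (simp add: time_average_def field_simps)
qed

lemma time_average_diff:
  assumes "continuous_on {0..} f" "continuous_on {0..} g"
  shows "time_average (\<lambda>s. f s - g s) t = time_average f t - time_average g t"
  unfolding time_average_def
  by (simp add: integral_diff integrable_half_line assms scaleR_diff_right)

text \<open>One antiperiod \<open>\<tau>\<close> is used for each \<open>e\<close>: the integrals of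
  \<open>f\<close> over \<open>{0..t}\<close> and over its translate by \<open>\<tau>\<close> cancel
  up to \<open>e * t\<close>, and they differ from each other only by two boundary pieces of length
  \<open>\<tau>\<close>, which are negligible for large \<open>t\<close>.\<close>

lemma almost_anti_periodic_mean_zero:
  fixes f :: "real \<Rightarrow> 'a::complex_banach"
  assumes I: "I = UNIV \<or> I = {0..}" and f: "almost_anti_periodic I f"
  shows "mean_zero f"
proof -
  obtain B where B: "B > 0" "\<And>t. t \<in> I \<Longrightarrow> norm (f t) \<le> B"
    using almost_periodic_bounded[OF I almost_anti_periodic_imp_almost_periodic[OF I f]] by blast
  have cont: "continuous_on {0..} f"
    using f I by (auto simp: almost_anti_periodic_def intro: continuous_on_subset)
  have half: "{0..} \<subseteq> I" using I by auto
  note int = integrable_half_line[OF cont]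
  have bound: "norm (integral {a..b} f) \<le> B * (b - a)" if "0 \<le> a" "a \<le> b" for a b
    by (rule integral_bound) (use that B(2)[OF subsetD[OF half]] in \<open>auto intro: continuous_on_subset[OF cont]\<close>)
  have "(time_average f \<longlongrightarrow> 0) at_top"
  proof (rule tendstoI)
    fix e :: real assume e: "e > 0"
    have "relatively_dense I (antiperiods I f e)" using f e by (simp add: almost_anti_periodic_def)
    then obtain l where l: "l > 0"
      and meets: "\<And>a. {a..a + l} \<subseteq> I \<Longrightarrow> {a..a + l} \<inter> antiperiods I f e \<noteq> {}"
      unfolding relatively_dense_def by blast
    \<comment> \<open>Starting the window at 1 makes \<open>\<tau>\<close> positive, also on the
      whole line.\<close>
    have "{1..1 + l} \<subseteq> I" using I by auto
    from meets[OF this] obtain \<tau> where \<tau>: "\<tau> \<in> antiperiods I f e" "\<tau> \<ge> 1" by auto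
    have anti: "norm (f (s + \<tau>) + f s) \<le> e" if "s \<ge> 0" for s
      using \<tau>(1) that I by (auto simp: antiperiods_def)
    have est: "2 * norm (integral {0..t} f) \<le> e * t + 2 * (B * \<tau>)" if t: "t \<ge> 0" for t
    proof -
      have cs: "continuous_on {0..t} (\<lambda>s. f (s + \<tau>))" "continuous_on {0..t} f"
        using \<tau>(2) by (auto intro!: continuous_on_compose2[OF cont] continuous_intros)
      have "integral {0..t} (\<lambda>s. f (s + \<tau>)) = integral {\<tau>..t + \<tau>} f"
        using integral_shift_Icc_real[of 0 t f \<tau>] by (simp add: o_def add.commute)
      then have "integral {\<tau>..t + \<tau>} f + integral {0..t} f = integral {0..t} (\<lambda>s. f (s + \<tau>) + f s)"
        using cs by (simp add: integral_add integrable_continuous_real)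
      also have "norm \<dots> \<le> e * (t - 0)"
        by (rule integral_bound) (use t anti cs in \<open>auto intro: continuous_on_add\<close>)
      finally have 1: "norm (integral {\<tau>..t + \<tau>} f + integral {0..t} f) \<le> e * t" by simp
      have "integral {0..t} f + integral {t..t + \<tau>} f = integral {0..\<tau>} f + integral {\<tau>..t + \<tau>} f"
        using Henstock_Kurzweil_Integration.integral_combine[where f = f and a = 0 and c = t and b = "t + \<tau>"] Henstock_Kurzweil_Integration.integral_combine[where f = f and a = 0 and c = \<tau> and b = "t + \<tau>"] int[of 0 "t + \<tau>"] t \<tau>(2)
        by simp
      then have "2 *\<^sub>R integral {0..t} f
          = (integral {\<tau>..t + \<tau>} f + integral {0..t} f) + integral {0..\<tau>} f - integral {t..t + \<tau>} f"
        by (simp add: scaleR_2 algebra_simps)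
      also have "norm \<dots> \<le> e * t + B * \<tau> + B * \<tau>"
        using bound[of 0 \<tau>] bound[of t "t + \<tau>"] t \<tau>(2)
        by (intro order_trans[OF norm_triangle_ineq4] add_mono order_trans[OF norm_triangle_ineq] 1) auto
      finally show ?thesis by simp
    qed
    show "\<forall>\<^sub>F t in at_top. dist (time_average f t) 0 < e"
      using eventually_gt_at_top[of 0] eventually_gt_at_top[of "2 * (B * \<tau>) / e"]
    proof eventually_elim
      case (elim t)
      then have "2 * (B * \<tau>) < e * t" using e by (simp add: field_simps)
      then have "norm (integral {0..t} f) < e * t" using est[of t] elim by simp
      then show ?case using elim by (simp add: time_average_def field_simps)
    qed
  qed
  with cont show ?thesis by (simp add: mean_zero_def)
qed

text \<open>The functions with \<open>mean_zero\<close> form a complex subspace that contains the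
  generators of the span.\<close>

lemma ANP0_mean_zero:
  fixes g :: "real \<Rightarrow> 'a::complex_banach"
  assumes I: "I = UNIV \<or> I = {0..}" and g: "g \<in> ANP0 I"
  shows "mean_zero g"
proof -
  interpret funs: vector_space "fun_scaleC :: complex \<Rightarrow> (real \<Rightarrow> 'a) \<Rightarrow> real \<Rightarrow> 'a"
    by (rule vector_space_fun_scaleC)
  show ?thesis
    using g unfolding ANP0_def
  proof (induction rule: funs.span_induct)
    case base
    show ?case
    proof (rule funs.subspaceI)
      show "0 \<in> Collect (mean_zero :: (real \<Rightarrow> 'a) \<Rightarrow> bool)"
        by (simp add: mean_zero_def time_average_def[abs_def] zero_fun_def)
    next
      fix f g :: "real \<Rightarrow> 'a" assume "f \<in> Collect mean_zero" "g \<in> Collect mean_zero"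
      then have fg: "continuous_on {0..} f" "continuous_on {0..} g"
        "(time_average f \<longlongrightarrow> 0) at_top" "(time_average g \<longlongrightarrow> 0) at_top"
        by (auto simp: mean_zero_def)
      have "time_average (f + g) = (\<lambda>t. time_average f t + time_average g t)"
        using fg(1,2) by (simp add: fun_eq_iff time_average_def plus_fun_def integral_add integrable_half_line scaleR_add_right)
      moreover have "continuous_on {0..} (f + g)" using fg by (auto simp: plus_fun_def intro: continuous_on_add)
      ultimately show "f + g \<in> Collect mean_zero"
        using tendsto_add[OF fg(3,4)] by (simp add: mean_zero_def)
    next
      fix c and f :: "real \<Rightarrow> 'a" assume "f \<in> Collect mean_zero"
      then have f: "continuous_on {0..} f" "(time_average f \<longlongrightarrow> 0) at_top" by (auto simp: mean_zero_def)
      have "time_average (fun_scaleC c f) = (\<lambda>t. c *\<^sub>C time_average f t)"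
      proof
        fix t
        have "integral {0..t} (\<lambda>s. c *\<^sub>C f s) = c *\<^sub>C integral {0..t} f"
          using integral_linear[OF integrable_half_line[OF f(1)] bounded_linear_scaleC_right, of 0 t c]
          by (simp add: o_def)
        then show "time_average (fun_scaleC c f) t = c *\<^sub>C time_average f t"
          by (simp add: time_average_def fun_scaleC_def scaleR_scaleC scaleC_scaleC mult.commute)
      qed
      moreover have "continuous_on {0..} (fun_scaleC c f)"
        unfolding fun_scaleC_def by (rule bounded_linear.continuous_on[OF bounded_linear_scaleC_right f(1)])
      ultimately show "fun_scaleC c f \<in> Collect mean_zero"
        using bounded_linear.tendsto[OF bounded_linear_scaleC_right f(2), of c] by (simp add: mean_zero_def)
    qed
  next
    case (step f)
    then show ?case using almost_anti_periodic_mean_zero[OF I] by blast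
  qed
qed

lemma bohr_transform_zero: "bohr_transform 0 f = Lim at_top (time_average f)"
  by (simp add: bohr_transform_def time_average_def[abs_def] scaleC_one)

text \<open>\<open>Lim\<close> denotes some value even without convergence, so
  \<open>Lim at_top (time_average f) = 0\<close> is informative only once the mean is known to
  exist. Approximate constants \<open>x n\<close> with error \<open>1 / Suc n\<close> form a Cauchy
  sequence, and its limit is the limit of \<open>m\<close>.\<close>

lemma convergent_if_approximately_constant:
  fixes m :: "'b \<Rightarrow> 'a::banach"
  assumes F: "F \<noteq> bot" and approx: "\<And>e. e > 0 \<Longrightarrow> \<exists>x. \<forall>\<^sub>F t in F. norm (m t - x) \<le> e"
  obtains y where "(m \<longlongrightarrow> y) F"
proof -
  have "\<forall>n. \<exists>x. \<forall>\<^sub>F t in F. norm (m t - x) \<le> 1 / real (Suc n)" using approx by simp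
  then obtain x where x: "\<And>n. \<forall>\<^sub>F t in F. norm (m t - x n) \<le> 1 / real (Suc n)" by metis
  have close: "norm (x k - x n) \<le> 1 / real (Suc k) + 1 / real (Suc n)" for k n
  proof -
    have "\<forall>\<^sub>F t in F. norm (x k - x n) \<le> 1 / real (Suc k) + 1 / real (Suc n)"
      using x[of k] x[of n]
    proof eventually_elim
      case (elim t)
      then show ?case using norm_triangle_ineq4[of "m t - x n" "m t - x k"] by simp
    qed
    then show ?thesis using F by simp
  qed
  have small: "\<exists>N. \<forall>n\<ge>N. 1 / real (Suc n) < e" if e: "e > 0" for e
  proof -
    obtain N where "1 / real (Suc N) < e" using nat_approx_posE[OF e] by blast
    moreover have "1 / real (Suc n) \<le> 1 / real (Suc N)" if "n \<ge> N" for n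
      using that by (intro divide_left_mono) auto
    ultimately show ?thesis by (meson le_less_trans)
  qed
  have "Cauchy x"
  proof (rule CauchyI)
    fix e :: real assume "e > 0"
    then obtain N where N: "\<And>n. n \<ge> N \<Longrightarrow> 1 / real (Suc n) < e / 2" using small[of "e / 2"] by auto
    have "norm (x k - x n) < e" if "k \<ge> N" "n \<ge> N" for k n
      using close[of k n] N[OF that(1)] N[OF that(2)] by linarith
    then show "\<exists>N. \<forall>k\<ge>N. \<forall>n\<ge>N. norm (x k - x n) < e" by blast
  qed
  then obtain y where y: "x \<longlonglongrightarrow> y" using Cauchy_convergent convergent_def by blast
  have "(m \<longlongrightarrow> y) F"
  proof (rule tendstoI)
    fix e :: real assume e: "e > 0"
    then obtain N where N: "\<And>n. n \<ge> N \<Longrightarrow> 1 / real (Suc n) < e / 2" using small[of "e / 2"] by auto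
    have "\<forall>\<^sub>F n in sequentially. n \<ge> N \<and> dist (x n) y < e / 2"
      using eventually_ge_at_top[of N] tendstoD[OF y, of "e / 2"] e by (simp add: eventually_conj)
    from eventually_happens'[OF sequentially_bot this] obtain n where n: "n \<ge> N" "dist (x n) y < e / 2" by blast
    show "\<forall>\<^sub>F t in F. dist (m t) y < e"
      using x[of n]
    proof eventually_elim
      case (elim t)
      then show ?case using n N[of n] dist_triangle[of "m t" y "x n"] by (simp add: dist_norm)
    qed
  qed
  then show ?thesis by (rule that)
qed

section \<open>The sup-distance and the closure of the span\<close>

lemma sup_dist_le:
  assumes "I \<noteq> {}" "\<And>t. t \<in> I \<Longrightarrow> norm (f t - g t) \<le> e"
  shows "sup_dist I f g \<le> e"
proof -
  have "bounded ((\<lambda>t. f t - g t) ` I)" using assms(2) by (auto simp: bounded_iff)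
  then show ?thesis using assms by (auto simp: sup_dist_def sup_norm_def intro: cSUP_least)
qed

text \<open>Boundedness of the functions in \<open>AP I\<close> excludes the default value 0 of
  \<open>sup_norm\<close>, for which the inequality could fail.\<close>

lemma norm_diff_le_sup_dist:
  assumes I: "I = UNIV \<or> I = {0..}" and fg: "f \<in> AP I" "g \<in> AP I" and t: "t \<in> I"
  shows "norm (f t - g t) \<le> sup_dist I f g"
proof -
  have b: "bounded ((\<lambda>t. f t - g t) ` I)"
    using AP_bounded[OF I fg(1)] AP_bounded[OF I fg(2)] by (rule bounded_minus_comp)
  then have "norm (f t - g t) \<le> (SUP t\<in>I. norm (f t - g t))"
    using t by (intro cSUP_upper) (auto simp: bounded_iff bdd_above_def)
  then show ?thesis using b by (simp add: sup_dist_def sup_norm_def)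
qed

text \<open>Balls of the metric space lie in its carrier; this is where the intersection with
  \<open>AP I\<close> comes from.\<close>

lemma ANP_iff:
  assumes I: "I = UNIV \<or> I = {0..}"
  shows "f \<in> ANP I \<longleftrightarrow> f \<in> AP I \<and> (\<forall>r>0. \<exists>g\<in>ANP0 I \<inter> AP I. sup_dist I f g < r)"
proof -
  interpret AP: Metric_space "AP I :: (real \<Rightarrow> 'a) set" "sup_dist I" by (rule AP_Metric_space[OF I])
  show ?thesis unfolding ANP_def AP.metric_closure_of by auto
qed

theorem theorem2p6:
  fixes I :: "real set"
  assumes "I = UNIV \<or> I = {0..}"
  shows "(ANP I :: (real \<Rightarrow> 'a::complex_banach) set) = AP_spec (UNIV - {0}) I"
proof -
  note I = assms
  have ne: "I \<noteq> {}" and half: "{0..} \<subseteq> I" using I by auto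
  have cont: "continuous_on {0..} f" if "f \<in> AP I" for f :: "real \<Rightarrow> 'a"
    using that half by (auto simp: AP_def almost_periodic_def intro: continuous_on_subset)
  have spec: "f \<in> AP_spec (UNIV - {0}) I \<longleftrightarrow> f \<in> AP I \<and> Lim at_top (time_average f) = 0" for f :: "real \<Rightarrow> 'a"
    unfolding bohr_transform_zero[symmetric] by (auto simp: AP_spec_def bohr_spectrum_def)
  \<comment> \<open>The inclusion from left to right: uniform closeness bounds the difference of the
    averages for every \<open>t > 0\<close>, and the averages of \<open>g\<close> tend to 0.\<close>
  have "Lim at_top (time_average f) = 0" if f: "f \<in> ANP I" for f :: "real \<Rightarrow> 'a"
  proof (rule tendsto_Lim[OF _ tendstoI])
    fix e :: real assume e: "e > 0"
    have fAP: "f \<in> AP I" using f by (simp add: ANP_iff[OF I])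
    obtain g where g: "g \<in> ANP0 I" "g \<in> AP I" "sup_dist I f g < e / 2"
      using f e unfolding ANP_iff[OF I] by (meson IntE half_gt_zero)
    have close: "norm (f s - g s) \<le> e / 2" if "s \<ge> 0" for s
      using norm_diff_le_sup_dist[OF I fAP g(2), of s] g(3) half that by auto
    have "\<forall>\<^sub>F t in at_top. dist (time_average g t) 0 < e / 2"
      using ANP0_mean_zero[OF I g(1)] e by (intro tendstoD) (auto simp: mean_zero_def)
    then show "\<forall>\<^sub>F t in at_top. dist (time_average f t) 0 < e"
      using eventually_gt_at_top[of 0]
    proof eventually_elim
      case (elim t)
      have "norm (time_average (\<lambda>s. f s - g s) t) \<le> e / 2"
        by (rule time_average_bound) (use close elim cont fAP g(2) in \<open>auto intro: continuous_on_diff\<close>)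
      then show ?case
        using elim norm_triangle_ineq[of "time_average f t - time_average g t" "time_average g t"]
        by (simp add: time_average_diff[OF cont[OF fAP] cont[OF g(2)]])
    qed
  qed simp
  then have sub: "ANP I \<subseteq> (AP_spec (UNIV - {0}) I :: (real \<Rightarrow> 'a) set)"
    using spec ANP_iff[OF I] by blast
  \<comment> \<open>A trigonometric approximant is split into its part \<open>Q\<close> with nonzero
    frequencies and its constant term \<open>y\<close>. The statement is used twice: for arbitrary
    \<open>e\<close> it yields the existence of the mean, and afterwards it bounds
    \<open>y\<close>.\<close>
  have approx: "\<exists>Q\<in>ANP0 I \<inter> AP I. \<exists>y. (\<forall>t\<in>I. norm (f t - Q t - y) \<le> e)
      \<and> (\<forall>\<^sub>F t in at_top. norm (time_average f t - y) \<le> 2 * e)"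
    if f: "f \<in> AP I" and e: "e > 0" for f :: "real \<Rightarrow> 'a" and e
  proof -
    interpret funs: vector_space "fun_scaleC :: complex \<Rightarrow> (real \<Rightarrow> 'a) \<Rightarrow> real \<Rightarrow> 'a"
      by (rule vector_space_fun_scaleC)
    obtain J :: nat and \<omega> x where x: "\<And>t. t \<in> I \<Longrightarrow> norm (f t - (\<Sum>j<J. cis (\<omega> j * t) *\<^sub>C x j)) \<le> e"
      using almost_periodic_approximation[OF I _ e, of f] f unfolding AP_def by blast
    \<comment> \<open>The frequencies need not be distinct, so the constant term collects all
      indices with \<open>\<omega> j = 0\<close>.\<close>
    define x' where "x' j = (if \<omega> j = 0 then 0 else x j)" for j
    define y where "y = (\<Sum>j<J. if \<omega> j = 0 then x j else 0)"
    define q where "q j t = (if t \<in> I then cis (\<omega> j * t) *\<^sub>C x' j else 0)" for j t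
    define Q where "Q = (\<Sum>j<J. q j)"
    have Q_apply: "Q t = (\<Sum>j<J. q j t)" for t unfolding Q_def by (induction J) simp_all
    have Q: "Q t = (\<Sum>j<J. cis (\<omega> j * t) *\<^sub>C x' j)" if "t \<in> I" for t
      using that by (simp add: Q_apply q_def)
    have "q j \<in> ANP0 I" for j
    proof (cases "\<omega> j = 0")
      case True
      then have "q j = 0" by (simp add: q_def x'_def fun_eq_iff)
      then show ?thesis by (simp add: ANP0_def funs.span_zero)
    next
      case False
      have "almost_anti_periodic I (q j)"
        using almost_anti_periodic_cong[OF I, of "q j" "\<lambda>t. cis (\<omega> j * t) *\<^sub>C x' j"]
          almost_anti_periodic_character[OF False] by (simp add: q_def)
      then show ?thesis unfolding ANP0_def by (intro funs.span_base) (simp add: functions_on_def q_def)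
    qed
    then have QANP: "Q \<in> ANP0 I" unfolding Q_def ANP0_def by (intro funs.span_sum)
    have "almost_periodic I Q"
      by (subst almost_periodic_cong[OF I Q]) (simp_all add: almost_periodic_trigonometric_polynomial)
    moreover have "Q t = 0" if "t \<notin> I" for t using that by (simp add: Q_apply q_def)
    ultimately have QAP: "Q \<in> AP I" by (simp add: AP_def functions_on_def)
    have close: "norm (f t - Q t - y) \<le> e" if t: "t \<in> I" for t
    proof -
      have "(\<Sum>j<J. cis (\<omega> j * t) *\<^sub>C x j) = Q t + y"
        unfolding Q[OF t] y_def sum.distrib[symmetric] by (intro sum.cong) (auto simp: x'_def scaleC_one)
      then show ?thesis using x[OF t] by (simp add: algebra_simps)
    qed
    have "\<forall>\<^sub>F t in at_top. dist (time_average Q t) 0 < e"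
      using ANP0_mean_zero[OF I QANP] e by (intro tendstoD) (auto simp: mean_zero_def)
    then have "\<forall>\<^sub>F t in at_top. norm (time_average f t - y) \<le> 2 * e"
      using eventually_gt_at_top[of 0]
    proof eventually_elim
      case (elim t)
      have fQ: "continuous_on {0..} (\<lambda>s. f s - Q s)" using cont f QAP by (intro continuous_on_diff)
      have "norm (time_average (\<lambda>s. (f s - Q s) - y) t) \<le> e"
        by (rule time_average_bound) (use close half elim fQ in \<open>auto intro: continuous_on_diff\<close>)
      moreover have "time_average (\<lambda>_. y) t = y" using elim by (simp add: time_average_def)
      ultimately have "norm (time_average f t - time_average Q t - y) \<le> e"
        by (simp add: time_average_diff fQ cont f QAP)
      then show ?case
        using elim norm_triangle_ineq[of "time_average f t - time_average Q t - y" "time_average Q t"] by simp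
    qed
    with close QANP QAP show ?thesis by blast
  qed
  have "f \<in> ANP I" if f: "f \<in> AP I" and Lim: "Lim at_top (time_average f) = 0" for f :: "real \<Rightarrow> 'a"
    unfolding ANP_iff[OF I]
  proof (intro conjI allI impI f)
    fix r :: real assume r: "r > 0"
    have "\<exists>x. \<forall>\<^sub>F t in at_top. norm (time_average f t - x) \<le> e" if "e > 0" for e
      using approx[OF f, of "e / 2"] that by auto
    then obtain z where z: "(time_average f \<longlongrightarrow> z) at_top"
      using convergent_if_approximately_constant[of "at_top :: real filter" "time_average f"] by auto
    then have "z = 0" using Lim tendsto_Lim[OF trivial_limit_at_top_linorder z] by simp
    \<comment> \<open>The error \<open>e\<close> of the approximation and the bound
      \<open>2 * e\<close> for the constant term add up to \<open>3 * e < r\<close>.\<close>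
    define e where "e = r / 5"
    have e: "e > 0" using r by (simp add: e_def)
    obtain Q y where Q: "Q \<in> ANP0 I \<inter> AP I" and Qf: "\<forall>t\<in>I. norm (f t - Q t - y) \<le> e"
      and y: "\<forall>\<^sub>F t in at_top. norm (time_average f t - y) \<le> 2 * e"
      using approx[OF f e] by blast
    have "((\<lambda>t. norm (time_average f t - y)) \<longlongrightarrow> norm (0 - y)) at_top"
      using z \<open>z = 0\<close> by (intro tendsto_norm tendsto_diff tendsto_const) simp
    then have "norm (0 - y) \<le> 2 * e" by (rule tendsto_upperbound[OF _ y]) simp
    then have "norm (f t - Q t) \<le> 3 * e" if "t \<in> I" for t
      using Qf that norm_triangle_ineq[of "f t - Q t - y" y] by fastforce
    then have "sup_dist I f Q \<le> 3 * e" by (rule sup_dist_le[OF ne])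
    also have "\<dots> < r" using r by (simp add: e_def)
    finally show "\<exists>g\<in>ANP0 I \<inter> AP I. sup_dist I f g < r" using Q by blast
  qed
  with sub spec show ?thesis by blast
qed

end
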